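(* Let $q\in(0,1)$ and let $a,b,c$ be non-negative real numbers satisfying $0\le q(b-c)\le 1-cq$ and $0<a-c\le 1-c$. Then there exists a non-decreasing function $\mu:[0,1]\to[0,1]$ with $\mu(1)-\mu(0)=1$ such that, for $z\in\mathbb{D}$, $$\frac{z\,\Phi[a,bq;cq;q,qz]}{\Phi[a,b;c;q,qz]}=\int_0^1\frac{z}{1-tz}\,d\mu(t),$$ and this function (as given by the right-hand side) is analytic in the cut-plane $\mathbb{C}\setminus[1,\infty]$ and maps both the unit disk $\mathbb{D}$ and the half-plane $\{z\in\mathbb{C}:\mathrm{Re}\,z<1\}$ univalently onto domains convex in the direction of the imaginary axis.
   Context: $\mathbb{D}=\{z\in\mathbb{C}:|z|<1\}$. The $q$-shifted factorial is $(a;q)_0=1$, $(a;q)_n=(1-a)(1-aq)\cdots(1-aq^{n-1})$ for $n\ge1$. Heine's basic hypergeometric function is $$\Phi[a,b;c;q,z]=\sum_{n=0}^\infty\frac{(a;q)_n(b;q)_n}{(c;q)_n(q;q)_n}z^n,\qquad z\in\mathbb{D}.$$ A domain $D\subset\mathbb{C}$ is called convex in the direction of the imaginary axis if the intersection of $D$ with any line parallel to the imaginary axis is either empty or a line segment (connected; possibly unbounded). The set $\mathbb{C}\setminus[1,\infty]$ is the complex plane cut along the real ray from $1$ to $\infty$. "Univalent" means analytic and injective. The integral is a Stieltjes integral. *)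

theory Defs
  imports "HOL-Complex_Analysis.Complex_Analysis"
begin

definition q_shifted_factorial :: "'a::comm_ring_1 \<Rightarrow> 'a \<Rightarrow> nat \<Rightarrow> 'a" where
  "q_shifted_factorial a q n = (\<Prod>k<n. 1 - a * q ^ k)"

definition heine_Phi ::
    "complex \<Rightarrow> complex \<Rightarrow> complex \<Rightarrow> complex \<Rightarrow> complex \<Rightarrow> complex" where
  "heine_Phi a b c q z =
     (\<Sum>n. q_shifted_factorial a q n * q_shifted_factorial b q n /
           (q_shifted_factorial c q n * q_shifted_factorial q q n) * z ^ n)"

text \<open>
  Riemann--Stieltjes integral over a compact interval, as the limit of the tagged sums when
  the mesh tends to 0. The value of the integrator at the left end point matters: a jump
  immediately to the right of it contributes to the integral. (This rules out using the
  Lebesgue--Stieltjes measure \<^const>\<open>interval_measure\<close>, which needs a right-continuous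
  integrator.) Degenerate intervals in a tagged division contribute 0.
\<close>
definition has_stieltjes_integral ::
    "(real \<Rightarrow> 'a::real_normed_vector) \<Rightarrow> (real \<Rightarrow> real) \<Rightarrow> real \<Rightarrow> real \<Rightarrow> 'a \<Rightarrow> bool" where
  "has_stieltjes_integral f \<mu> u v I \<longleftrightarrow>
     (\<forall>e>0. \<exists>d>0. \<forall>p. p tagged_division_of {u..v} \<and> (\<forall>(x, K)\<in>p. Sup K - Inf K < d) \<longrightarrow>
        norm ((\<Sum>(x, K)\<in>p. (\<mu> (Sup K) - \<mu> (Inf K)) *\<^sub>R f x) - I) < e)"

definition stieltjes_integrable ::
    "(real \<Rightarrow> 'a::real_normed_vector) \<Rightarrow> (real \<Rightarrow> real) \<Rightarrow> real \<Rightarrow> real \<Rightarrow> bool" where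
  "stieltjes_integrable f \<mu> u v \<longleftrightarrow> (\<exists>I. has_stieltjes_integral f \<mu> u v I)"

definition stieltjes_integral ::
    "(real \<Rightarrow> 'a::real_normed_vector) \<Rightarrow> (real \<Rightarrow> real) \<Rightarrow> real \<Rightarrow> real \<Rightarrow> 'a" where
  "stieltjes_integral f \<mu> u v = (THE I. has_stieltjes_integral f \<mu> u v I)"

lemma has_stieltjes_integral_unique:
  assumes "has_stieltjes_integral f \<mu> u v I" "has_stieltjes_integral f \<mu> u v J"
  shows "I = J"
proof (rule ccontr)
  assume "I \<noteq> J"
  define e where "e = norm (I - J) / 2"
  define S where "S p = (\<Sum>(x, K)\<in>p. (\<mu> (Sup K) - \<mu> (Inf K)) *\<^sub>R f x)" for p
  have "e > 0" using \<open>I \<noteq> J\<close> by (simp add: e_def)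
  then obtain d1 where d1: "d1 > 0" "\<And>p. p tagged_division_of {u..v} \<Longrightarrow>
      (\<forall>(x, K)\<in>p. Sup K - Inf K < d1) \<Longrightarrow> norm (S p - I) < e"
    using assms(1) unfolding has_stieltjes_integral_def S_def by meson
  obtain d2 where d2: "d2 > 0" "\<And>p. p tagged_division_of {u..v} \<Longrightarrow>
      (\<forall>(x, K)\<in>p. Sup K - Inf K < d2) \<Longrightarrow> norm (S p - J) < e"
    using assms(2) \<open>e > 0\<close> unfolding has_stieltjes_integral_def S_def by meson
  define d where "d = min d1 d2"
  have "d > 0" using d1 d2 by (simp add: d_def)
  then have "gauge (\<lambda>x::real. ball x (d / 2))" by (simp add: gauge_ball)
  then obtain p where p: "p tagged_division_of {u..v}" "(\<lambda>x. ball x (d / 2)) fine p"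
    using fine_division_exists_real by blast
  have mesh: "Sup K - Inf K < d" if "(x, K) \<in> p" for x K
  proof -
    obtain s t where K: "K = cbox s t" and "x \<in> K"
      using p(1) \<open>(x, K) \<in> p\<close> by (meson tagged_division_ofD(2,4))
    moreover have "K \<subseteq> ball x (d / 2)" using p(2) that by (auto dest: fineD)
    moreover have "s \<le> t" using K \<open>x \<in> K\<close> by auto
    moreover from K \<open>s \<le> t\<close> have "s \<in> K" "t \<in> K" by auto
    ultimately have "s \<in> ball x (d / 2)" "t \<in> ball x (d / 2)" by blast+
    then have "t - s < d" by (auto simp: dist_real_def abs_if split: if_splits)
    then show ?thesis using K \<open>s \<le> t\<close> by simp
  qed
  have "norm (S p - I) < e" "norm (S p - J) < e"
    using d1(2)[OF p(1)] d2(2)[OF p(1)] mesh unfolding d_def by fastforce+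
  then have "norm ((S p - J) - (S p - I)) < 2 * e"
    using norm_triangle_ineq4[of "S p - J" "S p - I"] by linarith
  then show False by (simp add: e_def)
qed

definition cut_plane :: "complex set" where
  "cut_plane = - {z. Im z = 0 \<and> Re z \<ge> 1}"

definition convex_in_imaginary_direction :: "complex set \<Rightarrow> bool" where
  "convex_in_imaginary_direction D \<longleftrightarrow>
     D \<noteq> {} \<and> open D \<and> connected D \<and> (\<forall>x. connected (D \<inter> {w. Re w = x}))"

definition univalent_on :: "(complex \<Rightarrow> complex) \<Rightarrow> complex set \<Rightarrow> bool" where
  "univalent_on f S \<longleftrightarrow> f analytic_on S \<and> inj_on f S"

end

theory Submission
  imports Defs
begin

text \<open>
  The quotient of the two Heine functions has a continued fraction of the form
  \<open>1/(1 - (1 - g\<^sub>0) g\<^sub>1 z/(1 - (1 - g\<^sub>1) g\<^sub>2 z/(1 - \<dots>)))\<close>, obtained by iterating one contiguous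
  relation (\<open>heine_fps_contiguous\<close>). If \<open>g\<^sub>k = (a - c)/(1 - c)\<close> for the current parameters, then
  passing from \<open>(a, b, c)\<close> to \<open>(b q, a, c q)\<close> advances the fraction by one level, and the
  hypotheses ensure that the parameters stay in the region where \<open>0 \<le> g\<^sub>k \<le> 1\<close>.

  The Taylor coefficients of such a fraction are the moments \<open>\<langle>e\<^sub>0, T\<^sup>2\<^sup>n e\<^sub>0\<rangle>\<close> of the symmetric
  tridiagonal matrix \<open>T\<close> with zero diagonal and off-diagonal entries \<open>sqrt ((1 - g\<^sub>i\<^sub>-\<^sub>1) g\<^sub>i)\<close>
  (\<open>jacobi_fps\<close>). Because the weights form a chain sequence, \<open>T\<close> is a contraction, so
  \<open>T\<^sup>2\<^sup>k (1 - T\<^sup>2)\<^sup>m\<close> is positive semidefinite; this makes the coefficients completely monotone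
  (\<open>completely_monotone_jacobi\<close>) without any spectral theorem. Hausdorff's theorem
  (\<open>hausdorff_moment\<close>) then gives the distribution function \<open>\<mu>\<close>, and summing the moments
  gives the integral \<open>F z = \<integral> z/(1 - t z) d\<mu>(t)\<close>. The denominator has no zero in the disk: a
  zero would be shared by all the functions obtained from the shifted parameters, but these
  tend to the \<open>q\<close>-exponential function, which has no zeros (\<open>heine_series_nonzero\<close>).

  Everything else is a property of \<open>F\<close> for an arbitrary \<open>\<mu>\<close>. Writing
  \<open>F z - F w = (z - w) \<integral> d\<mu>(t)/((1 - t z)(1 - t w))\<close>, injectivity on \<open>Re z < 1\<close> holds because
  the integrand stays in an open half-plane bounded by a line through 0 (\<open>F_inj\<close>).
  For the convexity, the disk and the half-plane are treated together: the map
  \<open>w \<mapsto> 2 w/(1 + w)\<close> carries the disk onto the half-plane and turns the kernel \<open>z/(1 - t z)\<close> into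
  \<open>2 w/(1 - (2 t - 1) w)\<close>. For every \<open>\<tau>\<close> in \<open>[-1, 1]\<close>, the real part of \<open>w/(1 - \<tau> w)\<close> increases
  strictly with \<open>Re w\<close> along each circle \<open>|w| = r < 1\<close>, and averaging preserves this. Hence
  the level sets of the real part meet each upper semicircle at most once and are connected
  (\<open>circle_level_sets_connected\<close>); their images are the vertical sections of the image domain.
\<close>

section \<open>Riemann--Stieltjes integrals against monotone functions\<close>

lemma ex_tagged_division_mesh:
  fixes u v d :: real
  assumes "d > 0"
  obtains p where "p tagged_division_of {u..v}" "\<forall>(x, K)\<in>p. Sup K - Inf K < d"
proof -
  have "gauge (\<lambda>x::real. ball x (d / 2))" using assms by (simp add: gauge_ball)
  then obtain p where p: "p tagged_division_of {u..v}" "(\<lambda>x. ball x (d / 2)) fine p"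
    using fine_division_exists_real by blast
  have "Sup K - Inf K < d" if "(x, K) \<in> p" for x K
  proof -
    obtain s t where K: "K = cbox s t" and "x \<in> K"
      using p(1) \<open>(x, K) \<in> p\<close> by (meson tagged_division_ofD(2,4))
    moreover have "K \<subseteq> ball x (d / 2)" using p(2) that by (auto dest: fineD)
    moreover have "s \<le> t" using K \<open>x \<in> K\<close> by auto
    moreover from K \<open>s \<le> t\<close> have "s \<in> K" "t \<in> K" by auto
    ultimately have "s \<in> ball x (d / 2)" "t \<in> ball x (d / 2)" by blast+
    then have "t - s < d" by (auto simp: dist_real_def abs_if split: if_splits)
    then show ?thesis using K \<open>s \<le> t\<close> by simp
  qed
  with p(1) show ?thesis by (intro that[of p]) auto
qed

lemma tagged_division_interval:
  fixes u v :: real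
  assumes "p tagged_division_of {u..v}" "(x, K) \<in> p"
  obtains s t where "K = {s..t}" "s \<le> x" "x \<le> t" "u \<le> s" "t \<le> v" "Inf K = s" "Sup K = t"
proof -
  obtain s t where K: "K = cbox s t" and "x \<in> K"
    using assms by (meson tagged_division_ofD(2,4))
  moreover have "K \<subseteq> {u..v}" using assms by (meson tagged_division_ofD(3))
  ultimately show ?thesis by (intro that[of s t]) auto
qed

definition stieltjes_sum :: "(real \<Rightarrow> 'a::real_normed_vector) \<Rightarrow> (real \<Rightarrow> real) \<Rightarrow>
    (real \<times> real set) set \<Rightarrow> 'a" where
  "stieltjes_sum f \<mu> p = (\<Sum>(x, K)\<in>p. (\<mu> (Sup K) - \<mu> (Inf K)) *\<^sub>R f x)"

lemma has_stieltjes_integralD: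
  assumes "has_stieltjes_integral f \<mu> u v I" "e > 0"
  obtains d where "d > 0"
    "\<And>p. p tagged_division_of {u..v} \<Longrightarrow> \<forall>(x, K)\<in>p. Sup K - Inf K < d \<Longrightarrow>
      norm (stieltjes_sum f \<mu> p - I) < e"
  using assms unfolding has_stieltjes_integral_def stieltjes_sum_def by meson

lemma has_stieltjes_integralI:
  assumes "\<And>e. e > 0 \<Longrightarrow> \<exists>d>0. \<forall>p. p tagged_division_of {u..v} \<longrightarrow>
      (\<forall>(x, K)\<in>p. Sup K - Inf K < d) \<longrightarrow> norm (stieltjes_sum f \<mu> p - I) < e"
  shows "has_stieltjes_integral f \<mu> u v I"
  using assms unfolding has_stieltjes_integral_def stieltjes_sum_def by (simp add: imp_conjL)

lemma stieltjes_integral_eq: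
  "has_stieltjes_integral f \<mu> u v I \<Longrightarrow> stieltjes_integral f \<mu> u v = I"
  unfolding stieltjes_integral_def by (blast intro: has_stieltjes_integral_unique)

lemma stieltjes_integrable_has:
  "stieltjes_integrable f \<mu> u v \<Longrightarrow> has_stieltjes_integral f \<mu> u v (stieltjes_integral f \<mu> u v)"
  unfolding stieltjes_integrable_def using stieltjes_integral_eq by metis

lemma has_stieltjes_integral_cong:
  assumes "\<And>x. x \<in> {u..v} \<Longrightarrow> f x = g x" and f: "has_stieltjes_integral f \<mu> u v I"
  shows "has_stieltjes_integral g \<mu> u v I"
proof -
  have "stieltjes_sum f \<mu> p = stieltjes_sum g \<mu> p" if "p tagged_division_of {u..v}" for p
    unfolding stieltjes_sum_def
  proof (rule sum.cong[OF refl], clarify)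
    fix x K assume "(x, K) \<in> p"
    with that obtain s t where "s \<le> x" "x \<le> t" "u \<le> s" "t \<le> v"
      by (rule tagged_division_interval)
    then show "(\<mu> (Sup K) - \<mu> (Inf K)) *\<^sub>R f x = (\<mu> (Sup K) - \<mu> (Inf K)) *\<^sub>R g x"
      using assms by simp
  qed
  then show ?thesis
    using f unfolding has_stieltjes_integral_def stieltjes_sum_def by simp
qed

lemma has_stieltjes_integral_bounded_linear:
  assumes f: "has_stieltjes_integral f \<mu> u v I" and h: "bounded_linear h"
  shows "has_stieltjes_integral (\<lambda>x. h (f x)) \<mu> u v (h I)"
proof (rule has_stieltjes_integralI)
  fix e :: real assume "e > 0"
  obtain B where B: "B > 0" "\<And>x. norm (h x) \<le> norm x * B"
    using bounded_linear.pos_bounded[OF h] by blast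
  obtain d where d: "d > 0" "\<And>p. p tagged_division_of {u..v} \<Longrightarrow>
      \<forall>(x, K)\<in>p. Sup K - Inf K < d \<Longrightarrow> norm (stieltjes_sum f \<mu> p - I) < e / B"
    using has_stieltjes_integralD[OF f, of "e / B"] \<open>e > 0\<close> B(1) by auto
  have lin: "stieltjes_sum (\<lambda>x. h (f x)) \<mu> p = h (stieltjes_sum f \<mu> p)" for p
    unfolding stieltjes_sum_def
    using h by (simp add: linear_sum[OF bounded_linear.linear] case_prod_beta
        linear_scale[OF bounded_linear.linear])
  have "norm (stieltjes_sum (\<lambda>x. h (f x)) \<mu> p - h I) < e"
    if "p tagged_division_of {u..v}" "\<forall>(x, K)\<in>p. Sup K - Inf K < d" for p
  proof -
    have "norm (stieltjes_sum (\<lambda>x. h (f x)) \<mu> p - h I) = norm (h (stieltjes_sum f \<mu> p - I))"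
      by (simp add: lin linear_diff[OF bounded_linear.linear[OF h]])
    also have "\<dots> \<le> norm (stieltjes_sum f \<mu> p - I) * B" by (rule B)
    also have "\<dots> < e" using d(2)[OF that] B(1) by (simp add: pos_less_divide_eq)
    finally show ?thesis .
  qed
  with d(1) show "\<exists>d>0. \<forall>p. p tagged_division_of {u..v} \<longrightarrow>
      (\<forall>(x, K)\<in>p. Sup K - Inf K < d) \<longrightarrow> norm (stieltjes_sum (\<lambda>x. h (f x)) \<mu> p - h I) < e"
    by blast
qed

lemma has_stieltjes_integral_add:
  assumes f: "has_stieltjes_integral f \<mu> u v I" and g: "has_stieltjes_integral g \<mu> u v J"
  shows "has_stieltjes_integral (\<lambda>x. f x + g x) \<mu> u v (I + J)"
proof (rule has_stieltjes_integralI)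
  fix e :: real assume "e > 0"
  obtain d1 where d1: "d1 > 0" "\<And>p. p tagged_division_of {u..v} \<Longrightarrow>
      \<forall>(x, K)\<in>p. Sup K - Inf K < d1 \<Longrightarrow> norm (stieltjes_sum f \<mu> p - I) < e / 2"
    using has_stieltjes_integralD[OF f, of "e / 2"] \<open>e > 0\<close> by auto
  obtain d2 where d2: "d2 > 0" "\<And>p. p tagged_division_of {u..v} \<Longrightarrow>
      \<forall>(x, K)\<in>p. Sup K - Inf K < d2 \<Longrightarrow> norm (stieltjes_sum g \<mu> p - J) < e / 2"
    using has_stieltjes_integralD[OF g, of "e / 2"] \<open>e > 0\<close> by auto
  have lin: "stieltjes_sum (\<lambda>x. f x + g x) \<mu> p = stieltjes_sum f \<mu> p + stieltjes_sum g \<mu> p" for p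
    unfolding stieltjes_sum_def by (simp add: case_prod_beta scaleR_add_right sum.distrib)
  have "norm (stieltjes_sum (\<lambda>x. f x + g x) \<mu> p - (I + J)) < e"
    if p: "p tagged_division_of {u..v}" and m: "\<forall>(x, K)\<in>p. Sup K - Inf K < min d1 d2" for p
  proof -
    have "norm (stieltjes_sum f \<mu> p - I) < e / 2" "norm (stieltjes_sum g \<mu> p - J) < e / 2"
      using d1(2)[OF p] d2(2)[OF p] m by fastforce+
    then show ?thesis unfolding lin
      using norm_triangle_ineq[of "stieltjes_sum f \<mu> p - I" "stieltjes_sum g \<mu> p - J"]
      by (simp add: algebra_simps)
  qed
  moreover have "min d1 d2 > 0" using d1 d2 by simp
  ultimately show "\<exists>d>0. \<forall>p. p tagged_division_of {u..v} \<longrightarrow>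
      (\<forall>(x, K)\<in>p. Sup K - Inf K < d) \<longrightarrow>
      norm (stieltjes_sum (\<lambda>x. f x + g x) \<mu> p - (I + J)) < e"
    by blast
qed

lemma stieltjes_increments_sum:
  fixes \<mu> :: "real \<Rightarrow> 'a::real_normed_vector"
  assumes "u \<le> v" "p tagged_division_of {u..v}"
  shows "(\<Sum>(x, K)\<in>p. \<mu> (Sup K) - \<mu> (Inf K)) = \<mu> v - \<mu> u"
  using additive_tagged_division_1[OF assms] by simp

lemma has_stieltjes_integral_norm_bound:
  assumes "has_stieltjes_integral f \<mu> u v I" "u \<le> v" and mono: "mono_on {u..v} \<mu>"
    and B: "\<And>x. x \<in> {u..v} \<Longrightarrow> norm (f x) \<le> B"
  shows "norm I \<le> B * (\<mu> v - \<mu> u)"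
proof (rule field_le_epsilon)
  fix e :: real assume "e > 0"
  then obtain d where d: "d > 0" "\<And>p. p tagged_division_of {u..v} \<Longrightarrow>
      \<forall>(x, K)\<in>p. Sup K - Inf K < d \<Longrightarrow> norm (stieltjes_sum f \<mu> p - I) < e"
    using has_stieltjes_integralD[OF assms(1)] by blast
  obtain p where p: "p tagged_division_of {u..v}" and m: "\<forall>(x, K)\<in>p. Sup K - Inf K < d"
    using ex_tagged_division_mesh[OF d(1)] by blast
  have "norm (stieltjes_sum f \<mu> p) \<le> (\<Sum>(x, K)\<in>p. B * (\<mu> (Sup K) - \<mu> (Inf K)))"
    unfolding stieltjes_sum_def
  proof (rule sum_norm_le, clarify)
    fix x K assume "(x, K) \<in> p"
    then obtain s t where K: "s \<le> x" "x \<le> t" "u \<le> s" "t \<le> v" "Inf K = s" "Sup K = t"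
      using tagged_division_interval[OF p] by metis
    then have "\<mu> s \<le> \<mu> t" using mono by (auto intro: mono_onD)
    moreover have "norm (f x) \<le> B" using B K by auto
    ultimately show "norm ((\<mu> (Sup K) - \<mu> (Inf K)) *\<^sub>R f x) \<le> B * (\<mu> (Sup K) - \<mu> (Inf K))"
      using K by (simp add: mult.commute mult_right_mono)
  qed
  also have "\<dots> = B * (\<mu> v - \<mu> u)"
    using stieltjes_increments_sum[OF \<open>u \<le> v\<close> p, of \<mu>]
    by (simp add: sum_distrib_left[symmetric] case_prod_beta)
  finally have "norm (stieltjes_sum f \<mu> p) \<le> B * (\<mu> v - \<mu> u)" .
  moreover have "norm (stieltjes_sum f \<mu> p - I) < e" using d(2)[OF p m] .
  ultimately show "norm I \<le> B * (\<mu> v - \<mu> u) + e"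
    using norm_triangle_ineq2[of I "stieltjes_sum f \<mu> p"] by (simp add: norm_minus_commute)
qed

lemma has_stieltjes_integral_lower_bound:
  fixes f :: "real \<Rightarrow> real"
  assumes "has_stieltjes_integral f \<mu> u v I" "u \<le> v" and mono: "mono_on {u..v} \<mu>"
    and B: "\<And>x. x \<in> {u..v} \<Longrightarrow> B \<le> f x"
  shows "B * (\<mu> v - \<mu> u) \<le> I"
proof (rule field_le_epsilon)
  fix e :: real assume "e > 0"
  then obtain d where d: "d > 0" "\<And>p. p tagged_division_of {u..v} \<Longrightarrow>
      \<forall>(x, K)\<in>p. Sup K - Inf K < d \<Longrightarrow> norm (stieltjes_sum f \<mu> p - I) < e"
    using has_stieltjes_integralD[OF assms(1)] by blast
  obtain p where p: "p tagged_division_of {u..v}" and m: "\<forall>(x, K)\<in>p. Sup K - Inf K < d"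
    using ex_tagged_division_mesh[OF d(1)] by blast
  have "B * (\<mu> v - \<mu> u) = (\<Sum>(x, K)\<in>p. B * (\<mu> (Sup K) - \<mu> (Inf K)))"
    using stieltjes_increments_sum[OF \<open>u \<le> v\<close> p, of \<mu>]
    by (simp add: sum_distrib_left[symmetric] case_prod_beta)
  also have "\<dots> \<le> stieltjes_sum f \<mu> p"
    unfolding stieltjes_sum_def
  proof (rule sum_mono, clarify)
    fix x K assume "(x, K) \<in> p"
    then obtain s t where K: "s \<le> x" "x \<le> t" "u \<le> s" "t \<le> v" "Inf K = s" "Sup K = t"
      using tagged_division_interval[OF p] by metis
    then have "\<mu> s \<le> \<mu> t" using mono by (auto intro: mono_onD)
    moreover have "B \<le> f x" using B K by auto
    ultimately show "B * (\<mu> (Sup K) - \<mu> (Inf K)) \<le> (\<mu> (Sup K) - \<mu> (Inf K)) *\<^sub>R f x"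
      using K by (simp add: mult.commute mult_right_mono)
  qed
  finally have "B * (\<mu> v - \<mu> u) \<le> stieltjes_sum f \<mu> p" .
  moreover have "norm (stieltjes_sum f \<mu> p - I) < e" using d(2)[OF p m] .
  ultimately show "B * (\<mu> v - \<mu> u) \<le> I + e" by (simp add: abs_if split: if_splits)
qed

lemma has_stieltjes_integral_pos:
  fixes f :: "real \<Rightarrow> real"
  assumes "has_stieltjes_integral f \<mu> u v I" "u \<le> v" "mono_on {u..v} \<mu>" "\<mu> u < \<mu> v"
    and cont: "continuous_on {u..v} f" and pos: "\<And>x. x \<in> {u..v} \<Longrightarrow> 0 < f x"
  shows "0 < I"
proof -
  obtain x0 where "x0 \<in> {u..v}" "\<And>x. x \<in> {u..v} \<Longrightarrow> f x0 \<le> f x"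
    using continuous_attains_inf[OF compact_Icc _ cont] \<open>u \<le> v\<close> by auto
  then have "f x0 * (\<mu> v - \<mu> u) \<le> I" "f x0 > 0"
    using has_stieltjes_integral_lower_bound[OF assms(1-3)] pos by auto
  moreover have "f x0 * (\<mu> v - \<mu> u) > 0" using \<open>f x0 > 0\<close> \<open>\<mu> u < \<mu> v\<close> by simp
  ultimately show ?thesis by linarith
qed

text \<open>
  The sum over the atoms of a discrete distribution telescopes over any division, just as the
  increments of its distribution function do. So the tagged sum and the exact value differ only by
  the oscillation of \<open>f\<close> on the pieces, uniformly in the distribution. All atoms lie strictly to
  the right of \<open>u\<close>, so that no mass is lost at the left end point.
\<close>
lemma stieltjes_sum_near_discrete:
  fixes f :: "real \<Rightarrow> 'a::real_normed_vector" and w \<theta> :: "'i \<Rightarrow> real" and J :: "'i set"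
  defines "\<nu> \<equiv> \<lambda>t. \<Sum>k\<in>{k\<in>J. \<theta> k \<le> t}. w k"
  assumes "finite J" and w: "\<And>k. k \<in> J \<Longrightarrow> 0 \<le> w k"
    and \<theta>: "\<And>k. k \<in> J \<Longrightarrow> u < \<theta> k \<and> \<theta> k \<le> v" and "u \<le> v"
    and p: "p tagged_division_of {u..v}" and mesh: "\<forall>(x, K)\<in>p. Sup K - Inf K < d"
    and close: "\<And>x y. x \<in> {u..v} \<Longrightarrow> y \<in> {u..v} \<Longrightarrow> \<bar>x - y\<bar> < d \<Longrightarrow> norm (f x - f y) \<le> e"
  shows "norm (stieltjes_sum f \<nu> p - (\<Sum>k\<in>J. w k *\<^sub>R f (\<theta> k))) \<le> e * (\<Sum>k\<in>J. w k)"
proof -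
  \<comment> \<open>the integral of \<open>f\<close> over \<open>[u, t]\<close> against the discrete distribution\<close>
  define g where "g t = (\<Sum>k\<in>{k\<in>J. \<theta> k \<le> t}. w k *\<^sub>R f (\<theta> k))" for t
  have jump: "(\<Sum>k\<in>{k\<in>J. \<theta> k \<le> t}. h k) - (\<Sum>k\<in>{k\<in>J. \<theta> k \<le> s}. h k)
      = (\<Sum>k\<in>{k\<in>J. s < \<theta> k \<and> \<theta> k \<le> t}. h k)" if "s \<le> t" for s t and h :: "'i \<Rightarrow> 'b::real_normed_vector"
  proof -
    have "{k\<in>J. \<theta> k \<le> t} = {k\<in>J. \<theta> k \<le> s} \<union> {k\<in>J. s < \<theta> k \<and> \<theta> k \<le> t}" using that by auto
    then have "(\<Sum>k\<in>{k\<in>J. \<theta> k \<le> t}. h k)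
        = (\<Sum>k\<in>{k\<in>J. \<theta> k \<le> s}. h k) + (\<Sum>k\<in>{k\<in>J. s < \<theta> k \<and> \<theta> k \<le> t}. h k)"
      using \<open>finite J\<close> by (simp add: sum.union_disjoint disjoint_iff)
    then show ?thesis by simp
  qed
  have ends: "{k\<in>J. \<theta> k \<le> v} = J" "{k\<in>J. \<theta> k \<le> u} = {}" using \<theta> by force+
  have tot: "g v - g u = (\<Sum>k\<in>J. w k *\<^sub>R f (\<theta> k))" "\<nu> v - \<nu> u = (\<Sum>k\<in>J. w k)"
    unfolding g_def \<nu>_def ends by simp_all
  have "stieltjes_sum f \<nu> p - (\<Sum>k\<in>J. w k *\<^sub>R f (\<theta> k))
      = (\<Sum>(x, K)\<in>p. (\<nu> (Sup K) - \<nu> (Inf K)) *\<^sub>R f x - (g (Sup K) - g (Inf K)))"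
    unfolding tot(1)[symmetric] stieltjes_increments_sum[OF \<open>u \<le> v\<close> p, of g, symmetric] stieltjes_sum_def
    by (simp add: sum_subtractf case_prod_beta)
  also have "norm \<dots> \<le> (\<Sum>(x, K)\<in>p. e * (\<nu> (Sup K) - \<nu> (Inf K)))"
  proof (rule sum_norm_le, clarify)
    fix x K assume xK: "(x, K) \<in> p"
    then obtain s t where K: "s \<le> x" "x \<le> t" "u \<le> s" "t \<le> v" "Inf K = s" "Sup K = t"
      using tagged_division_interval[OF p] by metis
    have "t - s < d" using mesh xK K by auto
    let ?M = "{k\<in>J. s < \<theta> k \<and> \<theta> k \<le> t}"
    have "s \<le> t" using K by simp
    have "(\<nu> t - \<nu> s) *\<^sub>R f x - (g t - g s) = (\<Sum>k\<in>?M. w k *\<^sub>R (f x - f (\<theta> k)))"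
      unfolding \<nu>_def g_def jump[OF \<open>s \<le> t\<close>]
      by (simp add: scaleR_sum_left scaleR_diff_right sum_subtractf)
    also have "norm \<dots> \<le> (\<Sum>k\<in>?M. e * w k)"
    proof (rule sum_norm_le)
      fix k assume k: "k \<in> ?M"
      then have "norm (f x - f (\<theta> k)) \<le> e" using K \<open>t - s < d\<close> by (intro close) auto
      then show "norm (w k *\<^sub>R (f x - f (\<theta> k))) \<le> e * w k"
        using mult_left_mono[of _ e "w k"] w[of k] k by (simp add: mult.commute[of e])
    qed
    also have "\<dots> = e * (\<nu> t - \<nu> s)"
      unfolding \<nu>_def jump[OF \<open>s \<le> t\<close>] by (simp add: sum_distrib_left)
    finally show "norm ((\<nu> (Sup K) - \<nu> (Inf K)) *\<^sub>R f x - (g (Sup K) - g (Inf K)))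
        \<le> e * (\<nu> (Sup K) - \<nu> (Inf K))" using K by simp
  qed
  also have "\<dots> = e * (\<nu> v - \<nu> u)"
    using stieltjes_increments_sum[OF \<open>u \<le> v\<close> p, of \<nu>]
    by (simp add: sum_distrib_left[symmetric] case_prod_beta)
  finally show ?thesis unfolding tot(2) .
qed

text \<open>
  Cluster points replace convergent subsequences. A cluster point of distribution functions under
  pointwise convergence comes directly from Tychonoff's theorem, and it is just as useful here,
  because a tagged sum involves only finitely many evaluation points.
\<close>
lemma compact_frequently_cluster:
  assumes "compact K" "\<And>n::nat. X n \<in> K"
  obtains x where "x \<in> K" "\<forall>U. open U \<and> x \<in> U \<longrightarrow> frequently (\<lambda>n. X n \<in> U) sequentially"
proof -
  have "filtermap X sequentially \<noteq> bot" "eventually (\<lambda>x. x \<in> K) (filtermap X sequentially)"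
    using assms(2) by (auto simp: filtermap_bot_iff eventually_filtermap)
  then obtain x where x: "x \<in> K" "inf (nhds x) (filtermap X sequentially) \<noteq> bot"
    using assms(1) unfolding compact_filter by blast
  have "frequently (\<lambda>n. X n \<in> U) sequentially" if "open U" "x \<in> U" for U
  proof (rule ccontr)
    assume "\<not> ?thesis"
    then have "eventually (\<lambda>y. y \<notin> U) (filtermap X sequentially)"
      by (simp add: not_frequently eventually_filtermap)
    moreover have "eventually (\<lambda>y. y \<in> U) (nhds x)" using that by (rule eventually_nhds_in_open)
    ultimately have "eventually (\<lambda>_. False) (inf (nhds x) (filtermap X sequentially))"
      unfolding eventually_inf by blast
    then show False using x(2) by (simp add: trivial_limit_def)
  qed
  with x(1) show ?thesis using that by blast
qed

lemma compact_distribution_functions: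
  "compact {\<nu> :: real \<Rightarrow> real. mono \<nu> \<and> range \<nu> \<subseteq> {0..1} \<and> \<nu> 0 = 0 \<and> \<nu> 1 = 1}"
proof -
  have "compact (PiE UNIV (\<lambda>_::real. {0..1::real}))"
    using compactin_PiE[of "\<lambda>_::real. euclidean :: real topology" UNIV "\<lambda>_. {0..1}"]
    by (simp only: euclidean_product_topology compactin_euclidean_iff compact_Icc simp_thms ball_simps)
  moreover have "closed {\<nu> :: real \<Rightarrow> real. mono \<nu> \<and> \<nu> 0 = 0 \<and> \<nu> 1 = 1}"
    unfolding mono_def
    by (intro closed_Collect_conj closed_Collect_all closed_Collect_imp closed_Collect_le
        closed_Collect_eq open_Collect_const continuous_on_product_coordinates continuous_on_const)
  ultimately have "compact ({\<nu> :: real \<Rightarrow> real. mono \<nu> \<and> \<nu> 0 = 0 \<and> \<nu> 1 = 1} \<inter> PiE UNIV (\<lambda>_. {0..1}))"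
    by (rule closed_Int_compact[rotated])
  moreover have "{\<nu> :: real \<Rightarrow> real. mono \<nu> \<and> \<nu> 0 = 0 \<and> \<nu> 1 = 1} \<inter> PiE UNIV (\<lambda>_. {0..1})
      = {\<nu>. mono \<nu> \<and> range \<nu> \<subseteq> {0..1} \<and> \<nu> 0 = 0 \<and> \<nu> 1 = 1}"
    by (auto simp: PiE_iff image_subset_iff)
  ultimately show ?thesis by simp
qed

lemma stieltjes_sum_continuous:
  "continuous_on UNIV (\<lambda>\<nu>. stieltjes_sum f \<nu> p)"
  unfolding stieltjes_sum_def case_prod_beta
  by (intro continuous_intros continuous_on_product_coordinates)

text \<open>
  A form of Helly's selection theorem in which the approximation holds at every point and not only at
  the points of continuity of the limit: \<open>\<mu>\<close> is a cluster point of the step functions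
  of the discrete distributions. A tagged sum for \<open>\<mu>\<close> is close to the same sum for some step
  function, hence to the corresponding discrete average, and the error depends only on the mesh.
  This gives both the Cauchy criterion for integrability and the value of the integral.
\<close>
lemma helly_discrete:
  fixes w \<theta> :: "nat \<Rightarrow> nat \<Rightarrow> real"
  assumes w: "\<And>n k. k \<le> n \<Longrightarrow> 0 \<le> w n k" and w1: "\<And>n. (\<Sum>k\<le>n. w n k) = 1"
    and \<theta>: "\<And>n k. k \<le> n \<Longrightarrow> 0 < \<theta> n k \<and> \<theta> n k \<le> 1"
  obtains \<mu> :: "real \<Rightarrow> real" where "mono \<mu>" "range \<mu> \<subseteq> {0..1}" "\<mu> 0 = 0" "\<mu> 1 = 1"
    "\<forall>f :: real \<Rightarrow> 'a::banach. continuous_on {0..1} f \<longrightarrow> stieltjes_integrable f \<mu> 0 1"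
    "\<forall>(f :: real \<Rightarrow> 'a) L. continuous_on {0..1} f \<longrightarrow>
       (\<lambda>n. \<Sum>k\<le>n. w n k *\<^sub>R f (\<theta> n k)) \<longlonglongrightarrow> L \<longrightarrow> has_stieltjes_integral f \<mu> 0 1 L"
proof -
  define \<nu> where "\<nu> n t = (\<Sum>k\<in>{k\<in>{..n}. \<theta> n k \<le> t}. w n k)" for n t
  have "\<nu> n \<in> {\<nu>. mono \<nu> \<and> range \<nu> \<subseteq> {0..1} \<and> \<nu> 0 = 0 \<and> \<nu> 1 = 1}" for n
  proof -
    have m: "mono (\<nu> n)"
      unfolding \<nu>_def by (intro monoI sum_mono2) (auto intro: w)
    have "0 \<le> \<nu> n t" for t unfolding \<nu>_def by (intro sum_nonneg) (auto intro: w)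
    moreover have "\<nu> n t \<le> 1" for t
      unfolding \<nu>_def w1[of n, symmetric] by (intro sum_mono2) (auto intro: w)
    moreover have "{k\<in>{..n}. \<theta> n k \<le> 0} = {}" "{k\<in>{..n}. \<theta> n k \<le> 1} = {..n}" using \<theta> by force+
    then have "\<nu> n 0 = 0" "\<nu> n 1 = 1" unfolding \<nu>_def by (simp_all only: w1 sum.empty)
    ultimately show ?thesis using m by auto
  qed
  then obtain \<mu> where "\<mu> \<in> {\<nu>. mono \<nu> \<and> range \<nu> \<subseteq> {0..1} \<and> \<nu> 0 = 0 \<and> \<nu> 1 = 1}"
    and freq: "\<forall>U. open U \<and> \<mu> \<in> U \<longrightarrow> frequently (\<lambda>n. \<nu> n \<in> U) sequentially"
    using compact_frequently_cluster[OF compact_distribution_functions, of \<nu>] by blast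
  then have \<mu>: "mono \<mu>" "range \<mu> \<subseteq> {0..1}" "\<mu> 0 = 0" "\<mu> 1 = 1" by simp_all
  define \<Lambda> where "\<Lambda> f n = (\<Sum>k\<le>n. w n k *\<^sub>R f (\<theta> n k))" for f :: "real \<Rightarrow> 'a" and n
  have near: "\<exists>d>0. \<forall>p n. p tagged_division_of {0..1} \<longrightarrow> (\<forall>(x, K)\<in>p. Sup K - Inf K < d) \<longrightarrow>
      norm (stieltjes_sum f (\<nu> n) p - \<Lambda> f n) \<le> e"
    if "continuous_on {0..1} f" "e > 0" for f :: "real \<Rightarrow> 'a" and e
  proof -
    have "uniformly_continuous_on {0..1} f"
      using that(1) by (intro compact_uniformly_continuous) auto
    then obtain d where d: "d > 0"
      "\<And>x y. x \<in> {0..1} \<Longrightarrow> y \<in> {0..1} \<Longrightarrow> dist x y < d \<Longrightarrow> dist (f x) (f y) < e"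
      using \<open>e > 0\<close> unfolding uniformly_continuous_on_def by metis
    have "norm (stieltjes_sum f (\<nu> n) p - \<Lambda> f n) \<le> e * (\<Sum>k\<le>n. w n k)"
      if "p tagged_division_of {0..1}" "\<forall>(x, K)\<in>p. Sup K - Inf K < d" for p n
      unfolding \<nu>_def \<Lambda>_def
    proof (rule stieltjes_sum_near_discrete[OF _ _ _ _ that])
      fix x y :: real assume "x \<in> {0..1}" "y \<in> {0..1}" "\<bar>x - y\<bar> < d"
      then have "dist (f x) (f y) < e" using d(2)[of x y] by (simp add: dist_real_def)
      then show "norm (f x - f y) \<le> e" by (simp add: dist_norm)
    qed (simp_all add: w \<theta>)
    then show ?thesis using d(1) w1 by auto
  qed
  have near2: "norm (stieltjes_sum f \<mu> p - stieltjes_sum f \<mu> p') \<le> 2 * e"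
    if d: "\<forall>p n. p tagged_division_of {0..1} \<longrightarrow> (\<forall>(x, K)\<in>p. Sup K - Inf K < d) \<longrightarrow>
      norm (stieltjes_sum f (\<nu> n) p - \<Lambda> f n) \<le> e"
      and p: "p tagged_division_of {0..1}" "\<forall>(x, K)\<in>p. Sup K - Inf K < d"
      and p': "p' tagged_division_of {0..1}" "\<forall>(x, K)\<in>p'. Sup K - Inf K < d"
    for f :: "real \<Rightarrow> 'a" and d e p p'
  proof (rule ccontr)
    let ?U = "{\<nu>. 2 * e < norm (stieltjes_sum f \<nu> p - stieltjes_sum f \<nu> p')}"
    assume "\<not> ?thesis"
    then have "\<mu> \<in> ?U" by simp
    moreover have "open ?U"
      by (intro open_Collect_less continuous_intros stieltjes_sum_continuous)
    ultimately have "frequently (\<lambda>n. \<nu> n \<in> ?U) sequentially" using freq by blast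
    then obtain n where "\<nu> n \<in> ?U" using frequently_ex by blast
    moreover have "norm (stieltjes_sum f (\<nu> n) p - \<Lambda> f n) \<le> e"
      "norm (stieltjes_sum f (\<nu> n) p' - \<Lambda> f n) \<le> e" using d p p' by simp_all
    ultimately show False
      using norm_triangle_ineq4[of "stieltjes_sum f (\<nu> n) p - \<Lambda> f n"
          "stieltjes_sum f (\<nu> n) p' - \<Lambda> f n"] by simp
  qed
  have integrable: "stieltjes_integrable f \<mu> 0 1"
    if f: "continuous_on {0..1} f" for f :: "real \<Rightarrow> 'a"
  proof -
    have "\<forall>n::nat. \<exists>p. p tagged_division_of {0..1} \<and> (\<forall>(x, K)\<in>p. Sup K - Inf K < 1 / real (Suc n))"
    proof
      fix n :: nat
      show "\<exists>p. p tagged_division_of {0..1} \<and> (\<forall>(x, K)\<in>p. Sup K - Inf K < 1 / real (Suc n))"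
        by (rule ex_tagged_division_mesh[of "1 / real (Suc n)" 0 1]) auto
    qed
    then obtain P where "\<forall>n. P n tagged_division_of {0..1} \<and> (\<forall>(x, K)\<in>P n. Sup K - Inf K < 1 / real (Suc n))"
      by (rule choice[THEN exE])
    then have P: "P n tagged_division_of {0..1}" "\<forall>(x, K)\<in>P n. Sup K - Inf K < 1 / real (Suc n)" for n
      by auto
    have mesh: "\<exists>N. \<forall>n\<ge>N. \<forall>(x, K)\<in>P n. Sup K - Inf K < d" if "d > 0" for d
    proof -
      obtain N where N: "1 / real (Suc N) < d" using \<open>d > 0\<close> nat_approx_posE by blast
      have "Sup K - Inf K < d" if "n \<ge> N" "(x, K) \<in> P n" for n x K
      proof -
        have "Sup K - Inf K < 1 / real (Suc n)" using P(2) that(2) by blast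
        also have "\<dots> \<le> 1 / real (Suc N)" using that(1) by (simp add: frac_le)
        finally show ?thesis using N by simp
      qed
      then show ?thesis by blast
    qed
    have "Cauchy (\<lambda>n. stieltjes_sum f \<mu> (P n))"
    proof (rule CauchyI)
      fix e :: real assume "e > 0"
      then obtain d where d: "d > 0" "\<forall>p n. p tagged_division_of {0..1} \<longrightarrow>
        (\<forall>(x, K)\<in>p. Sup K - Inf K < d) \<longrightarrow> norm (stieltjes_sum f (\<nu> n) p - \<Lambda> f n) \<le> e / 3"
        using near[OF f, of "e / 3"] by auto
      obtain N where "\<forall>n\<ge>N. \<forall>(x, K)\<in>P n. Sup K - Inf K < d" using mesh[OF d(1)] ..
      then have N: "\<forall>(x, K)\<in>P n. Sup K - Inf K < d" if "n \<ge> N" for n using that by simp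
      have "norm (stieltjes_sum f \<mu> (P m) - stieltjes_sum f \<mu> (P n)) < e" if "m \<ge> N" "n \<ge> N" for m n
        using near2[OF d(2) P(1) N[OF that(1)] P(1) N[OF that(2)]] \<open>e > 0\<close> by simp
      then show "\<exists>M. \<forall>m\<ge>M. \<forall>n\<ge>M. norm (stieltjes_sum f \<mu> (P m) - stieltjes_sum f \<mu> (P n)) < e"
        by blast
    qed
    then obtain I where I: "(\<lambda>n. stieltjes_sum f \<mu> (P n)) \<longlonglongrightarrow> I"
      using Cauchy_convergent convergent_def by blast
    have "has_stieltjes_integral f \<mu> 0 1 I"
    proof (rule has_stieltjes_integralI)
      fix e :: real assume "e > 0"
      then obtain d where d: "d > 0" "\<forall>p n. p tagged_division_of {0..1} \<longrightarrow>
        (\<forall>(x, K)\<in>p. Sup K - Inf K < d) \<longrightarrow> norm (stieltjes_sum f (\<nu> n) p - \<Lambda> f n) \<le> e / 3"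
        using near[OF f, of "e / 3"] by auto
      obtain N where "\<forall>n\<ge>N. \<forall>(x, K)\<in>P n. Sup K - Inf K < d" using mesh[OF d(1)] ..
      then have N: "\<forall>(x, K)\<in>P n. Sup K - Inf K < d" if "n \<ge> N" for n using that by simp
      have "norm (stieltjes_sum f \<mu> p - I) < e"
        if p: "p tagged_division_of {0..1}" "\<forall>(x, K)\<in>p. Sup K - Inf K < d" for p
      proof -
        have "(\<lambda>n. norm (stieltjes_sum f \<mu> p - stieltjes_sum f \<mu> (P n)))
            \<longlonglongrightarrow> norm (stieltjes_sum f \<mu> p - I)"
          by (intro tendsto_intros I)
        moreover have "norm (stieltjes_sum f \<mu> p - stieltjes_sum f \<mu> (P n)) \<le> 2 * (e / 3)"
          if "n \<ge> N" for n
          using near2[OF d(2) p P(1) N[OF that]] .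
        ultimately have "norm (stieltjes_sum f \<mu> p - I) \<le> 2 * (e / 3)"
          by (intro LIMSEQ_le_const2) blast+
        then show ?thesis using \<open>e > 0\<close> by simp
      qed
      then show "\<exists>d>0. \<forall>p. p tagged_division_of {0..1} \<longrightarrow>
        (\<forall>(x, K)\<in>p. Sup K - Inf K < d) \<longrightarrow> norm (stieltjes_sum f \<mu> p - I) < e"
        using d(1) by blast
    qed
    then show ?thesis unfolding stieltjes_integrable_def by blast
  qed
  have limit: "has_stieltjes_integral f \<mu> 0 1 L"
    if f: "continuous_on {0..1} f" and L: "\<Lambda> f \<longlonglongrightarrow> L" for f :: "real \<Rightarrow> 'a" and L
  proof -
    obtain I where I: "has_stieltjes_integral f \<mu> 0 1 I"
      using integrable[OF f] unfolding stieltjes_integrable_def by blast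
    have "norm (I - L) \<le> 0"
    proof (rule field_le_epsilon)
      fix e :: real assume "e > 0"
      then obtain d where d: "d > 0" "\<forall>p n. p tagged_division_of {0..1} \<longrightarrow>
        (\<forall>(x, K)\<in>p. Sup K - Inf K < d) \<longrightarrow> norm (stieltjes_sum f (\<nu> n) p - \<Lambda> f n) \<le> e / 4"
        using near[OF f, of "e / 4"] by auto
      obtain d' where d': "d' > 0" "\<And>p. p tagged_division_of {0..1} \<Longrightarrow>
        \<forall>(x, K)\<in>p. Sup K - Inf K < d' \<Longrightarrow> norm (stieltjes_sum f \<mu> p - I) < e / 4"
        using has_stieltjes_integralD[OF I, of "e / 4"] \<open>e > 0\<close> by auto
      obtain p where p: "p tagged_division_of {0..1}" and m: "\<forall>(x, K)\<in>p. Sup K - Inf K < min d d'"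
        using ex_tagged_division_mesh[of "min d d'" 0 1] d d' by auto
      let ?U = "{\<nu>. norm (stieltjes_sum f \<nu> p - stieltjes_sum f \<mu> p) < e / 4}"
      have "open ?U"
        by (intro open_Collect_less continuous_intros stieltjes_sum_continuous)
      moreover have "\<mu> \<in> ?U" using \<open>e > 0\<close> by simp
      ultimately have "frequently (\<lambda>n. \<nu> n \<in> ?U) sequentially" using freq by blast
      moreover have "eventually (\<lambda>n. norm (\<Lambda> f n - L) < e / 4) sequentially"
        using tendstoD[OF L, of "e / 4"] \<open>e > 0\<close> by (simp only: dist_norm divide_pos_pos zero_less_numeral)
      ultimately have "frequently (\<lambda>n. \<nu> n \<in> ?U \<and> norm (\<Lambda> f n - L) < e / 4) sequentially"
        by (rule frequently_eventually_frequently)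
      then obtain n where n: "norm (stieltjes_sum f (\<nu> n) p - stieltjes_sum f \<mu> p) < e / 4"
        "norm (\<Lambda> f n - L) < e / 4" using frequently_ex by blast
      have m': "\<forall>(x, K)\<in>p. Sup K - Inf K < d" "\<forall>(x, K)\<in>p. Sup K - Inf K < d'"
        using m by auto
      have "norm (I - stieltjes_sum f \<mu> p) \<le> e / 4"
        using d'(2)[OF p m'(2)] by (simp add: norm_minus_commute)
      moreover have "norm (stieltjes_sum f \<mu> p - stieltjes_sum f (\<nu> n) p) \<le> e / 4"
        using n(1) by (simp add: norm_minus_commute)
      moreover have "norm (stieltjes_sum f (\<nu> n) p - \<Lambda> f n) \<le> e / 4"
        using d(2) p m'(1) by simp
      moreover have "norm (\<Lambda> f n - L) \<le> e / 4" using n(2) by simp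
      ultimately have "norm (I - L) \<le> e / 4 + (e / 4 + (e / 4 + e / 4))"
        by (intro norm_diff_triangle_le)
      then show "norm (I - L) \<le> 0 + e" by simp
    qed
    then show ?thesis using I by simp
  qed
  have "\<forall>f :: real \<Rightarrow> 'a. continuous_on {0..1} f \<longrightarrow> stieltjes_integrable f \<mu> 0 1"
    using integrable by simp
  moreover have "\<forall>(f :: real \<Rightarrow> 'a) L. continuous_on {0..1} f \<longrightarrow>
       (\<lambda>n. \<Sum>k\<le>n. w n k *\<^sub>R f (\<theta> n k)) \<longlonglongrightarrow> L \<longrightarrow> has_stieltjes_integral f \<mu> 0 1 L"
    using limit unfolding \<Lambda>_def by simp
  ultimately show ?thesis by (rule that[OF \<mu>])
qed

section \<open>The Hausdorff moment problem\<close>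

text \<open>
  Differences taken with the sign that makes them \<open>\<integral> t^k (1 - t)^m d\<mu>(t)\<close> when \<open>s\<close> is the moment
  sequence of \<open>\<mu>\<close>.
\<close>
fun iter_diff :: "(nat \<Rightarrow> real) \<Rightarrow> nat \<Rightarrow> nat \<Rightarrow> real" where
  "iter_diff s 0 k = s k"
| "iter_diff s (Suc m) k = iter_diff s m k - iter_diff s m (Suc k)"

definition completely_monotone :: "(nat \<Rightarrow> real) \<Rightarrow> bool" where
  "completely_monotone s \<longleftrightarrow> (\<forall>m k. 0 \<le> iter_diff s m k)"

lemma completely_monotone_bounds:
  assumes "completely_monotone s"
  shows "0 \<le> s n" "s n \<le> s 0"
proof -
  show "0 \<le> s n" using assms[unfolded completely_monotone_def, rule_format, of 0 n] by simp
  have "s (Suc k) \<le> s k" for k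
  proof -
    have "0 \<le> iter_diff s (Suc 0) k" using assms unfolding completely_monotone_def by blast
    then show ?thesis by simp
  qed
  then show "s n \<le> s 0" by (induction n) (auto intro: order_trans)
qed

text \<open>
  For a moment sequence this is the integral of \<open>t^j (t + (1 - t))^m\<close>; in general it follows from
  Pascal's rule.
\<close>
lemma binomial_sum_iter_diff:
  "(\<Sum>k\<le>m. real (m choose k) * iter_diff s (m - k) (j + k)) = s j"
proof (induction m)
  case (Suc m)
  have "(\<Sum>k\<le>Suc m. real (Suc m choose k) * iter_diff s (Suc m - k) (j + k))
      = iter_diff s (Suc m) j
        + (\<Sum>k\<le>m. real (Suc m choose Suc k) * iter_diff s (m - k) (j + Suc k))"
    by (subst sum.atMost_Suc_shift) simp
  also have "(\<Sum>k\<le>m. real (Suc m choose Suc k) * iter_diff s (m - k) (j + Suc k))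
      = (\<Sum>k\<le>m. real (m choose k) * iter_diff s (m - k) (j + Suc k))
        + (\<Sum>k\<le>m. real (m choose Suc k) * iter_diff s (m - k) (j + Suc k))"
    by (simp add: sum.distrib algebra_simps)
  also have "iter_diff s (Suc m) j +
      ((\<Sum>k\<le>m. real (m choose k) * iter_diff s (m - k) (j + Suc k))
        + (\<Sum>k\<le>m. real (m choose Suc k) * iter_diff s (m - k) (j + Suc k)))
     = (\<Sum>k\<le>m. real (m choose k) * iter_diff s (m - k) (j + Suc k))
        + (\<Sum>k\<le>Suc m. real (m choose k) * iter_diff s (Suc m - k) (j + k))"
    by (subst sum.atMost_Suc_shift) simp
  also have "(\<Sum>k\<le>Suc m. real (m choose k) * iter_diff s (Suc m - k) (j + k))
     = (\<Sum>k\<le>m. real (m choose k) * iter_diff s (Suc (m - k)) (j + k))"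
    by (simp add: Suc_diff_le)
  also have "(\<Sum>k\<le>m. real (m choose k) * iter_diff s (m - k) (j + Suc k)) + \<dots>
     = (\<Sum>k\<le>m. real (m choose k) * iter_diff s (m - k) (j + k))"
    by (simp add: sum.distrib[symmetric] algebra_simps)
  finally show ?case using Suc.IH by simp
qed simp

text \<open>
  The Bernstein weights reproduce \<open>s j\<close> exactly when \<open>(k/n)^j\<close> is replaced by the ratio of falling
  factorials \<open>k (k-1) \<dots> (k-j+1) / (n (n-1) \<dots> (n-j+1))\<close>.
\<close>
lemma binomial_falling_sum_iter_diff:
  assumes "j \<le> n"
  shows "(\<Sum>k\<le>n. real (n choose k) * iter_diff s (n - k) k * (real (k choose j) / real (n choose j))) = s j"
proof -
  have "(\<Sum>k\<le>n. real (n choose k) * iter_diff s (n - k) k * (real (k choose j) / real (n choose j)))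
     = (\<Sum>k\<in>{j..n}. real (n choose k) * iter_diff s (n - k) k * (real (k choose j) / real (n choose j)))"
    by (rule sum.mono_neutral_right) auto
  also have "\<dots> = (\<Sum>k\<in>{j..n}. real ((n - j) choose (k - j)) * iter_diff s (n - k) k)"
  proof (rule sum.cong[OF refl])
    fix k assume "k \<in> {j..n}"
    then have "real (n choose k) * real (k choose j) = real (n choose j) * real ((n - j) choose (k - j))"
      using choose_mult[of j k n] by (metis atLeastAtMost_iff of_nat_mult)
    moreover have "real (n choose j) > 0" using assms by simp
    ultimately show "real (n choose k) * iter_diff s (n - k) k * (real (k choose j) / real (n choose j))
       = real ((n - j) choose (k - j)) * iter_diff s (n - k) k"
      by (simp add: field_simps)
  qed
  also have "\<dots> = (\<Sum>k\<le>n - j. real ((n - j) choose k) * iter_diff s (n - j - k) (j + k))"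
    by (rule sum.reindex_bij_witness[of _ "\<lambda>k. j + k" "\<lambda>k. k - j"]) (use assms in auto)
  also have "\<dots> = s j" by (rule binomial_sum_iter_diff)
  finally show ?thesis .
qed

lemma binomial_ratio_prod:
  assumes "j \<le> n"
  shows "real (k choose j) / real (n choose j) = (\<Prod>i<j. (real k - real i) / (real n - real i))"
  by (simp add: binomial_gbinomial gbinomial_prod_rev prod_dividef lessThan_atLeast0)

lemma power_near_binomial_ratio:
  assumes j: "2 * j \<le> n" "j < n" and "k \<le> n"
  shows "\<bar>((real k + 1) / (real n + 1)) ^ j - real (k choose j) / real (n choose j)\<bar>
    \<le> real j * ((real j + 1) / (real n - real j))"
proof -
  have "norm ((\<Prod>i<j. (real k + 1) / (real n + 1)) - (\<Prod>i<j. (real k - real i) / (real n - real i)))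
     \<le> (\<Sum>i<j. norm ((real k + 1) / (real n + 1) - (real k - real i) / (real n - real i)))"
  proof (rule norm_prod_diff)
    fix i assume i: "i \<in> {..<j}"
    show "norm ((real k + 1) / (real n + 1)) \<le> 1" using assms by simp
    have "\<bar>real k - real i\<bar> \<le> real n - real i" using assms i by auto
    moreover have "real n - real i > 0" using assms i by auto
    ultimately show "norm ((real k - real i) / (real n - real i)) \<le> 1" by (simp add: abs_divide)
  qed
  also have "\<dots> \<le> (\<Sum>i<j. (real j + 1) / (real n - real j))"
  proof (rule sum_mono)
    fix i assume i: "i \<in> {..<j}"
    have pos: "real n - real i > 0" "real n - real j > 0" using assms i by auto
    have eq: "(real k + 1) / (real n + 1) - (real k - real i) / (real n - real i)
       = (real i + 1) / (real n - real i) * ((real n - real k) / (real n + 1))"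
      using pos by (simp add: divide_simps) (simp add: algebra_simps)
    have "(real i + 1) / (real n - real i) * ((real n - real k) / (real n + 1))
       \<le> (real j + 1) / (real n - real j) * 1"
      using pos assms i by (intro mult_mono frac_le) (auto simp: divide_simps)
    moreover have "0 \<le> (real i + 1) / (real n - real i) * ((real n - real k) / (real n + 1))"
      using pos assms by simp
    ultimately show "norm ((real k + 1) / (real n + 1) - (real k - real i) / (real n - real i))
       \<le> (real j + 1) / (real n - real j)" unfolding eq real_norm_def by linarith
  qed
  finally show ?thesis using assms by (simp add: binomial_ratio_prod)
qed

text \<open>
  The discrete distributions with the Bernstein weights of \<open>s\<close> have moments converging to \<open>s\<close>. The
  atoms are \<open>(k + 1)/(n + 1)\<close> instead of the usual \<open>k/n\<close> so that they avoid the left end point 0.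
\<close>
lemma bernstein_moments_tendsto:
  assumes cm: "completely_monotone s" and "s 0 = 1"
  shows "(\<lambda>n. \<Sum>k\<le>n. real (n choose k) * iter_diff s (n - k) k * ((real k + 1) / (real n + 1)) ^ j)
    \<longlonglongrightarrow> s j"
proof -
  define w where "w n k = real (n choose k) * iter_diff s (n - k) k" for n k
  have w: "w n k \<ge> 0" for n k using cm by (simp add: w_def completely_monotone_def)
  have w1: "(\<Sum>k\<le>n. w n k) = 1" for n
    using binomial_sum_iter_diff[of n s 0] \<open>s 0 = 1\<close> by (simp add: w_def)
  have "\<bar>(\<Sum>k\<le>n. w n k * ((real k + 1) / (real n + 1)) ^ j) - s j\<bar>
     \<le> real j * ((real j + 1) / (real n - real j))" if n: "n \<ge> 2 * j + 1" for n
  proof -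
    have "(\<Sum>k\<le>n. w n k * ((real k + 1) / (real n + 1)) ^ j) - s j
       = (\<Sum>k\<le>n. w n k * (((real k + 1) / (real n + 1)) ^ j - real (k choose j) / real (n choose j)))"
      using binomial_falling_sum_iter_diff[of j n s] n
      by (simp add: w_def right_diff_distrib sum_subtractf)
    also have "\<bar>\<dots>\<bar> \<le> (\<Sum>k\<le>n. w n k * (real j * ((real j + 1) / (real n - real j))))"
    proof (rule order_trans[OF sum_abs sum_mono])
      fix k assume k: "k \<in> {..n}"
      have "\<bar>((real k + 1) / (real n + 1)) ^ j - real (k choose j) / real (n choose j)\<bar>
          \<le> real j * ((real j + 1) / (real n - real j))"
        by (rule power_near_binomial_ratio) (use n k in auto)
      from mult_left_mono[OF this w]
      show "\<bar>w n k * (((real k + 1) / (real n + 1)) ^ j - real (k choose j) / real (n choose j))\<bar>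
          \<le> w n k * (real j * ((real j + 1) / (real n - real j)))"
        by (simp only: abs_mult abs_of_nonneg[OF w])
    qed
    also have "\<dots> = (\<Sum>k\<le>n. w n k) * (real j * ((real j + 1) / (real n - real j)))"
      by (rule sum_distrib_right[symmetric])
    also have "\<dots> = real j * ((real j + 1) / (real n - real j))"
      by (simp only: w1 mult_1_left)
    finally show ?thesis .
  qed
  then have "\<forall>\<^sub>F n in sequentially. norm ((\<Sum>k\<le>n. w n k * ((real k + 1) / (real n + 1)) ^ j) - s j)
     \<le> real j * ((real j + 1) / (real n - real j))"
    unfolding real_norm_def eventually_sequentially by blast
  moreover have "(\<lambda>n. real j * ((real j + 1) / (real n - real j))) \<longlonglongrightarrow> 0"
  proof -
    have "filterlim (\<lambda>n. - real j + real n) at_top sequentially"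
      by (rule filterlim_tendsto_add_at_top[OF tendsto_const filterlim_real_sequentially])
    then have "(\<lambda>n. (real j + 1) / (- real j + real n)) \<longlonglongrightarrow> 0"
      by (intro tendsto_divide_0[OF tendsto_const] filterlim_at_top_imp_at_infinity)
    then show ?thesis using tendsto_mult_right_zero by (simp only: uminus_add_conv_diff)
  qed
  ultimately have "(\<lambda>n. (\<Sum>k\<le>n. w n k * ((real k + 1) / (real n + 1)) ^ j) - s j) \<longlonglongrightarrow> 0"
    by (rule Lim_null_comparison)
  then show ?thesis unfolding w_def by (rule LIM_zero_cancel)
qed

text \<open>
  Hausdorff's solution of the moment problem: \<open>\<mu>\<close> is a cluster point of the discrete distributions
  given by the Bernstein weights.
\<close>
theorem hausdorff_moment:
  assumes cm: "completely_monotone s" and "s 0 = 1"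
  obtains \<mu> :: "real \<Rightarrow> real" where "mono \<mu>" "range \<mu> \<subseteq> {0..1}" "\<mu> 0 = 0" "\<mu> 1 = 1"
    "\<forall>f :: real \<Rightarrow> complex. continuous_on {0..1} f \<longrightarrow> stieltjes_integrable f \<mu> 0 1"
    "\<forall>j. has_stieltjes_integral (\<lambda>t. of_real t ^ j :: complex) \<mu> 0 1 (of_real (s j))"
proof -
  define w where "w n k = real (n choose k) * iter_diff s (n - k) k" for n k
  define \<theta> where "\<theta> n k = (real k + 1) / (real n + 1)" for n k :: nat
  have w: "w n k \<ge> 0" for n k using cm by (simp add: w_def completely_monotone_def)
  have w1: "(\<Sum>k\<le>n. w n k) = 1" for n
    using binomial_sum_iter_diff[of n s 0] \<open>s 0 = 1\<close> by (simp add: w_def)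
  have \<theta>: "0 < \<theta> n k \<and> \<theta> n k \<le> 1" if "k \<le> n" for n k using that by (simp add: \<theta>_def)
  obtain \<mu> :: "real \<Rightarrow> real" where \<mu>: "mono \<mu>" "range \<mu> \<subseteq> {0..1}" "\<mu> 0 = 0" "\<mu> 1 = 1"
    and int: "\<forall>f :: real \<Rightarrow> complex. continuous_on {0..1} f \<longrightarrow> stieltjes_integrable f \<mu> 0 1"
    and lim: "\<forall>(f :: real \<Rightarrow> complex) L. continuous_on {0..1} f \<longrightarrow>
       (\<lambda>n. \<Sum>k\<le>n. w n k *\<^sub>R f (\<theta> n k)) \<longlonglongrightarrow> L \<longrightarrow> has_stieltjes_integral f \<mu> 0 1 L"
    by (rule helly_discrete[of w \<theta>, where 'a = complex, OF w w1 \<theta>])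
  have "has_stieltjes_integral (\<lambda>t. of_real t ^ j :: complex) \<mu> 0 1 (of_real (s j))" for j
  proof -
    have "(\<lambda>n. of_real (\<Sum>k\<le>n. w n k * \<theta> n k ^ j) :: complex) \<longlonglongrightarrow> of_real (s j)"
      using bernstein_moments_tendsto[OF assms, of j] unfolding w_def \<theta>_def by (rule tendsto_of_real)
    then have "(\<lambda>n. \<Sum>k\<le>n. w n k *\<^sub>R (of_real (\<theta> n k) ^ j :: complex)) \<longlonglongrightarrow> of_real (s j)"
      by (simp add: scaleR_conv_of_real)
    moreover have "continuous_on {0..1} (\<lambda>t. of_real t ^ j :: complex)" by (intro continuous_intros)
    ultimately show ?thesis using lim by blast
  qed
  then show ?thesis by (intro that[OF \<mu> int]) blast
qed

section \<open>Moments of a Jacobi operator and continued fractions\<close>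

text \<open>
  The off-diagonal entry between \<open>i - 1\<close> and \<open>i\<close>; only indices \<open>i \<ge> 1\<close> are meaningful.
\<close>
definition chain_weight :: "(nat \<Rightarrow> real) \<Rightarrow> nat \<Rightarrow> real" where
  "chain_weight g i = sqrt ((1 - g (i - 1)) * g i)"

definition jacobi_op :: "(nat \<Rightarrow> real) \<Rightarrow> (nat \<Rightarrow> real) \<Rightarrow> nat \<Rightarrow> real" where
  "jacobi_op g v i =
     (if i = 0 then 0 else chain_weight g i * v (i - 1)) + chain_weight g (Suc i) * v (Suc i)"

text \<open>
  The vector \<open>T^n e\<^sub>0\<close> of a Jacobi matrix \<open>T\<close> with zero diagonal. All these vectors have finite
  support, so that inner products are finite sums.
\<close>
definition jacobi_vec :: "(nat \<Rightarrow> real) \<Rightarrow> nat \<Rightarrow> nat \<Rightarrow> real" where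
  "jacobi_vec g n = (jacobi_op g ^^ n) (\<lambda>i. if i = 0 then 1 else 0)"

lemma jacobi_vec_0: "jacobi_vec g 0 = (\<lambda>i. if i = 0 then 1 else 0)"
  and jacobi_vec_Suc: "jacobi_vec g (Suc n) = jacobi_op g (jacobi_vec g n)"
  by (simp_all add: jacobi_vec_def)

lemma jacobi_vec_support: "n < i \<Longrightarrow> jacobi_vec g n i = 0"
  by (induction n arbitrary: i) (auto simp: jacobi_vec_0 jacobi_vec_Suc jacobi_op_def)

text \<open>
  The differences of order \<open>m\<close> are \<open>\<langle>e\<^sub>0, T\<^sup>2\<^sup>k (1 - T\<^sup>2)\<^sup>m e\<^sub>0\<rangle>\<close>. Let \<open>n\<close> be the integer part of \<open>m/2\<close>
  and \<open>v = T^k (1 - T\<^sup>2)^n e\<^sub>0\<close>. By symmetry of \<open>T\<close>, the difference is \<open>\<parallel>v\<parallel>\<^sup>2\<close> for even \<open>m\<close> and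
  \<open>\<parallel>v\<parallel>\<^sup>2 - \<parallel>T v\<parallel>\<^sup>2\<close> for odd \<open>m\<close>, and \<open>T\<close> is a contraction.
\<close>
lemma completely_monotone_jacobi:
  assumes g: "\<And>k. 0 \<le> g k \<and> g k \<le> 1"
  shows "completely_monotone (\<lambda>n. jacobi_vec g (2 * n) 0)"
proof -
  define \<alpha> where "\<alpha> = chain_weight g"
  define T where "T = jacobi_op g"
  define x where "x = jacobi_vec g"
  note \<alpha>_alt = chain_weight_def[of g, folded \<alpha>_def]
  note T_alt = jacobi_op_def[of g, folded \<alpha>_def T_def]
  define B where "B N v w = (\<Sum>i\<le>N. v i * w i)" for N :: nat and v w :: "nat \<Rightarrow> real"
  have sym: "B N (T v) w = B N v (T w)" if "v (Suc N) = 0" "w (Suc N) = 0" for N v w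
  proof -
    have "B N (T v) w - B N v (T w)
       = (\<Sum>i\<le>N. (if i = 0 then 0 else \<alpha> i * (w i * v (i - 1) - v i * w (i - 1)))
          - \<alpha> (Suc i) * (w (Suc i) * v i - v (Suc i) * w i))"
      unfolding B_def T_alt sum_subtractf[symmetric]
      by (intro sum.cong) (auto simp: algebra_simps)
    also have "\<dots> = - (\<alpha> (Suc N) * (w (Suc N) * v N - v (Suc N) * w N))"
      \<comment> \<open>the sum telescopes\<close>
      by (induction N) auto
    finally show ?thesis using that by simp
  qed
  have contr: "B N (T v) (T v) \<le> B N v v" if "v (Suc N) = 0" for N v
  proof -
    have "(T v i)\<^sup>2 \<le> (if i = 0 then 0 else (1 - g (i - 1)) * (v (i - 1))\<^sup>2) + g (Suc i) * (v (Suc i))\<^sup>2" for i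
    proof -
      define p where "p = sqrt (g i)"
      define r where "r = sqrt (1 - g i)"
      define y where "y = (if i = 0 then 0 else sqrt (1 - g (i - 1)) * v (i - 1))"
      define z where "z = sqrt (g (Suc i)) * v (Suc i)"
      have "T v i = p * y + r * z"
        unfolding T_alt \<alpha>_alt p_def r_def y_def z_def by (simp add: real_sqrt_mult)
      moreover have "p\<^sup>2 + r\<^sup>2 = 1" using g[of i] by (simp add: p_def r_def)
      \<comment> \<open>Cauchy--Schwarz for the vectors \<open>(p, r)\<close> and \<open>(y, z)\<close>\<close>
      moreover have "(p * y + r * z)\<^sup>2 + (p * z - r * y)\<^sup>2 = (p\<^sup>2 + r\<^sup>2) * (y\<^sup>2 + z\<^sup>2)"
        by (simp add: power2_eq_square algebra_simps)
      ultimately have "(T v i)\<^sup>2 \<le> y\<^sup>2 + z\<^sup>2" by (metis le_add_same_cancel1 mult_1 zero_le_power2)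
      then show ?thesis using g[of "i - 1"] g[of "Suc i"] by (simp add: y_def z_def power_mult_distrib split: if_splits)
    qed
    then have "B N (T v) (T v)
       \<le> (\<Sum>i\<le>N. (if i = 0 then 0 else (1 - g (i - 1)) * (v (i - 1))\<^sup>2) + g (Suc i) * (v (Suc i))\<^sup>2)"
      unfolding B_def by (intro sum_mono) (simp add: power2_eq_square)
    also have "\<dots> = B N v v + g (Suc N) * (v (Suc N))\<^sup>2 - g 0 * (v 0)\<^sup>2 - (1 - g N) * (v N)\<^sup>2"
      unfolding B_def by (induction N) (auto simp: power2_eq_square algebra_simps)
    also have "\<dots> \<le> B N v v" 
  proof -
      have "0 \<le> g 0 * (v 0)\<^sup>2" "0 \<le> (1 - g N) * (v N)\<^sup>2" using g[of 0] g[of N] by auto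
      then show ?thesis using that by simp
    qed
    finally show ?thesis .
  qed
  have x0: "x 0 = (\<lambda>i. if i = 0 then 1 else 0)" and xS: "\<And>n. x (Suc n) = T (x n)"
    by (simp_all add: x_def T_def jacobi_vec_0 jacobi_vec_Suc)
  have supp: "x n i = 0" if "n < i" for n i
    using that by (simp add: x_def jacobi_vec_support)
  have ip: "B N (x m) (x n) = x (m + n) 0" if "m + n \<le> N" for m n N
    using that
  proof (induction n arbitrary: m)
    case 0
    have "B N (x m) (x 0) = (\<Sum>i\<in>{0}. x m i * x 0 i)"
      unfolding B_def by (rule sum.mono_neutral_right) (auto simp: x0)
    then show ?case by (simp add: x0)
  next
    case (Suc n)
    have "B N (x m) (x (Suc n)) = B N (x (Suc m)) (x n)"
      unfolding xS by (rule sym[symmetric]) (use Suc.prems in \<open>auto intro: supp\<close>)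
    then show ?case using Suc.IH[of "Suc m"] Suc.prems by simp
  qed
  \<comment> \<open>the vectors \<open>T^k (1 - T\<^sup>2)^m e\<^sub>0\<close>\<close>
  define y where "y = rec_nat x (\<lambda>m ym k i. ym k i - ym (Suc (Suc k)) i)"
  have y0: "y 0 = x" and yS: "y (Suc m) k i = y m k i - y m (Suc (Suc k)) i" for m k i
    by (simp_all add: y_def)
  have yT: "y m (Suc k) = T (y m k)" for m k
  proof (induction m arbitrary: k)
    case 0
    show ?case by (simp add: y0 xS)
  next
    case (Suc m)
    show ?case
    proof
      fix i
      have "T (y (Suc m) k) i = T (y m k) i - T (y m (Suc (Suc k))) i"
        unfolding T_alt by (simp add: yS algebra_simps)
      then show "y (Suc m) (Suc k) i = T (y (Suc m) k) i" by (simp add: yS Suc.IH)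
    qed
  qed
  have ysupp: "y m k i = 0" if "k + 2 * m < i" for m k i
    using that by (induction m arbitrary: k) (auto simp: y0 yS supp)
  have yx: "B N (y m k) (x l) = y m (k + l) 0" if "k + 2 * m + l \<le> N" for N m k l
    using that
  proof (induction m arbitrary: k)
    case 0
    then show ?case by (simp add: y0 ip)
  next
    case (Suc m)
    have "B N (y (Suc m) k) (x l) = B N (y m k) (x l) - B N (y m (Suc (Suc k))) (x l)"
      by (simp add: B_def yS algebra_simps sum_subtractf)
    also have "\<dots> = y m (k + l) 0 - y m (Suc (Suc k) + l) 0"
      using Suc.IH[of k] Suc.IH[of "Suc (Suc k)"] Suc.prems by simp
    finally show ?case using yS[of m "k + l" 0] by (simp only: add_Suc)
  qed
  have yy: "B N (y m k) (y n l) = y (m + n) (k + l) 0" if "k + 2 * m + l + 2 * n \<le> N" for N m n k l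
    using that
  proof (induction n arbitrary: l)
    case 0
    then show ?case by (simp add: y0 yx)
  next
    case (Suc n)
    have "B N (y m k) (y (Suc n) l) = B N (y m k) (y n l) - B N (y m k) (y n (Suc (Suc l)))"
      by (simp add: B_def yS algebra_simps sum_subtractf)
    also have "\<dots> = y (m + n) (k + l) 0 - y (m + n) (k + Suc (Suc l)) 0"
      using Suc.IH[of l] Suc.IH[of "Suc (Suc l)"] Suc.prems by simp
    finally show ?case using yS[of "m + n" "k + l" 0] by (simp only: add_Suc_right)
  qed
  have diff: "iter_diff (\<lambda>n. x (2 * n) 0) m k = y m (2 * k) 0" for m k
    by (induction m arbitrary: k) (auto simp: y0 yS)
  have "0 \<le> y m (2 * k) 0" for m k
  proof (cases "even m")
    case True
    then obtain n where m: "m = n + n" by (metis evenE mult_2)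
    have "y m (2 * k) 0 = B (2 * k + 2 * m) (y n k) (y n k)"
      using yy[of k n k n "2 * k + 2 * m"] m by (simp add: mult_2)
    also have "\<dots> \<ge> 0" by (simp add: B_def sum_nonneg)
    finally show ?thesis .
  next
    case False
    then obtain n where m: "m = Suc (n + n)" by (metis oddE mult_2 Suc_eq_plus1)
    let ?N = "2 * k + 2 * m"
    have "y m (2 * k) 0 = y (n + n) (k + k) 0 - y (n + n) (Suc k + Suc k) 0"
      by (simp add: m yS mult_2)
    also have "\<dots> = B ?N (y n k) (y n k) - B ?N (T (y n k)) (T (y n k))"
      using m by (simp add: yy yT[symmetric])
    also have "\<dots> \<ge> 0" using contr[of "y n k" ?N] m by (simp add: ysupp)
    finally show ?thesis .
  qed
  then show ?thesis unfolding completely_monotone_def x_def[symmetric] diff by blast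
qed

text \<open>
  The three-term recurrence is the continued fraction of \<open>P 1 / P 0\<close>, written without division.
  Sorting walks by their last vertex, the generating functions \<open>H i\<close> of the entries \<open>(T^n e\<^sub>0)\<^sub>i\<close>
  satisfy the same recurrence as \<open>(\<alpha>\<^sub>1 \<cdots> \<alpha>\<^sub>i) P (i + 1) / P 0\<close>, with \<open>\<alpha>\<close> the off-diagonal entries of
  \<open>T\<close>. Entry \<open>i\<close> is nonzero only for powers \<open>n = i + 2 j\<close>, and \<open>H i\<close> records the coefficient for
  \<open>n\<close> at degree \<open>j\<close>. The recurrence determines its solution, because a coefficient depends only on
  lower degrees or on the same degree and a smaller index.
\<close>
lemma jacobi_fps:
  fixes P :: "nat \<Rightarrow> real fps"
  assumes g: "\<And>k. 0 \<le> g k \<and> g k \<le> 1"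
    and P: "\<And>k. P k = P (Suc k) - fps_const ((1 - g k) * g (Suc k)) * fps_X * P (Suc (Suc k))"
  shows "Abs_fps (\<lambda>n. jacobi_vec g (2 * n) 0) * P 0 = P 1"
proof -
  define H where "H i = Abs_fps (\<lambda>j. jacobi_vec g (i + 2 * j) i)" for i
  define A where "A i = (\<Prod>k=1..i. chain_weight g k)" for i
  have AS: "A (Suc i) = A i * chain_weight g (Suc i)" for i by (simp add: A_def)
  have sq: "chain_weight g (Suc i) * chain_weight g (Suc i) = (1 - g i) * g (Suc i)" for i
    using g[of i] g[of "Suc i"] by (simp add: chain_weight_def)
  define D where "D i = H i * P 0 - fps_const (A i) * P (Suc i)" for i
  have HS: "H (Suc i) = fps_const (chain_weight g (Suc i)) * H i
      + fps_const (chain_weight g (Suc (Suc i))) * (fps_X * H (Suc (Suc i)))" for i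
  proof (rule fps_ext)
    fix n
    show "fps_nth (H (Suc i)) n = fps_nth (fps_const (chain_weight g (Suc i)) * H i
      + fps_const (chain_weight g (Suc (Suc i))) * (fps_X * H (Suc (Suc i)))) n"
      by (cases n) (simp_all add: H_def jacobi_vec_Suc jacobi_op_def jacobi_vec_support)
  qed
  have H0: "H 0 = 1 + fps_const (chain_weight g 1) * (fps_X * H 1)"
  proof (rule fps_ext)
    fix n
    show "fps_nth (H 0) n = fps_nth (1 + fps_const (chain_weight g 1) * (fps_X * H 1)) n"
      by (cases n) (simp_all add: H_def jacobi_vec_0 jacobi_vec_Suc jacobi_op_def)
  qed
  have PS: "P (Suc k) = P k + fps_const ((1 - g k) * g (Suc k)) * fps_X * P (Suc (Suc k))" for k
    by (subst (2) P) simp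
  have D0: "D 0 = fps_const (chain_weight g 1) * (fps_X * D 1)"
  proof -
    have "D 0 = (H 0 - 1) * P 0 - (P 1 - P 0)" by (simp add: D_def A_def algebra_simps)
    also have "P 1 - P 0 = fps_const (chain_weight g 1 * chain_weight g 1) * fps_X * P (Suc 1)"
      using PS[of 0] sq[of 0] by simp
    also have "(H 0 - 1) = fps_const (chain_weight g 1) * (fps_X * H 1)" by (simp add: H0)
    finally show ?thesis
      by (simp add: D_def A_def fps_const_mult[symmetric] algebra_simps del: fps_const_mult)
  qed
  have DS: "D (Suc i) = fps_const (chain_weight g (Suc i)) * D i
      + fps_const (chain_weight g (Suc (Suc i))) * (fps_X * D (Suc (Suc i)))" for i
  proof -
    have "fps_const (A (Suc i)) * P (Suc (Suc i)) = fps_const (A i * chain_weight g (Suc i)) *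
      (P (Suc i) + fps_const (chain_weight g (Suc (Suc i)) * chain_weight g (Suc (Suc i))) * fps_X * P (Suc (Suc (Suc i))))"
      by (simp only: AS sq PS[of "Suc i", symmetric])
    then show ?thesis
      unfolding D_def HS[of i]
      by (simp add: AS fps_const_mult[symmetric] algebra_simps del: fps_const_mult)
  qed
  have "fps_nth (D i) n = 0" for n i
  proof (induction n arbitrary: i rule: less_induct)
    case (less n)
    have X: "fps_nth (fps_X * D k) n = 0" for k
      using less.IH by (cases n) auto
    show ?case
    proof (induction i)
      case 0
      show ?case by (subst D0) (simp only: fps_mult_left_const_nth X mult_zero_right)
    next
      case (Suc i)
      then show ?case by (subst DS) (simp only: fps_add_nth fps_mult_left_const_nth X mult_zero_right add_0)
    qed
  qed
  then have "D 0 = 0" by (intro fps_ext) simp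
  then show ?thesis by (simp add: D_def H_def A_def)
qed

section \<open>The quotient of contiguous Heine functions\<close>

text \<open>
  The power series in \<open>z\<close> of Heine's function at the argument \<open>q z\<close>.
\<close>
definition heine_fps :: "real \<Rightarrow> real \<Rightarrow> real \<Rightarrow> real \<Rightarrow> real fps" where
  "heine_fps q a b c = Abs_fps (\<lambda>n. q_shifted_factorial a q n * q_shifted_factorial b q n /
     (q_shifted_factorial c q n * q_shifted_factorial q q n) * q ^ n)"

lemma q_shifted_factorial_0 [simp]: "q_shifted_factorial x q 0 = 1"
  by (simp add: q_shifted_factorial_def)

lemma q_shifted_factorial_Suc:
  "q_shifted_factorial x q (Suc n) = q_shifted_factorial x q n * (1 - x * q ^ n)"
  by (simp add: q_shifted_factorial_def)

lemma q_shifted_factorial_Suc_left: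
  "q_shifted_factorial x q (Suc n) = (1 - x) * q_shifted_factorial (x * q) q n"
  unfolding q_shifted_factorial_def by (subst prod.lessThan_Suc_shift) (simp add: mult_ac)

lemma q_shifted_factorial_pos:
  fixes x q :: real
  assumes "0 < q" "q < 1" "x < 1"
  shows "0 < q_shifted_factorial x q n"
  unfolding q_shifted_factorial_def
proof (rule prod_pos)
  fix k
  have "0 < q ^ k" "q ^ k \<le> 1" using assms by (auto simp: power_le_one)
  then have "x * q ^ k < 1"
    using assms by (cases "x \<le> 0") (auto simp: mult_nonpos_nonneg intro: le_less_trans[of "x * q ^ k" x] le_less_trans[of _ 0] simp: mult_left_le)
  then show "0 < 1 - x * q ^ k" by simp
qed

lemma heine_fps_commute: "heine_fps q a b c = heine_fps q b a c"
  by (simp add: heine_fps_def mult.commute)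

text \<open>
  Comparing coefficients, everything reduces to the identity
  \<open>(1 - b q y)(1 - c) - (b - c)(1 - q y) = (1 - b)(1 - c q y)\<close> with \<open>y = q^(n-1)\<close>.
\<close>
lemma heine_fps_contiguous:
  assumes q: "0 < q" "q < 1" and c: "0 \<le> c" "c < 1"
  shows "heine_fps q a b c = heine_fps q a (b * q) (c * q)
     - fps_const ((1 - a) / (1 - c) * (q * (b - c) / (1 - c * q))) * fps_X
        * heine_fps q (a * q) (b * q) (c * q * q)"
proof (rule fps_ext)
  fix n
  show "fps_nth (heine_fps q a b c) n = fps_nth (heine_fps q a (b * q) (c * q)
     - fps_const ((1 - a) / (1 - c) * (q * (b - c) / (1 - c * q))) * fps_X
        * heine_fps q (a * q) (b * q) (c * q * q)) n"
  proof (cases n)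
    case 0
    then show ?thesis by (simp add: heine_fps_def)
  next
    case (Suc m)
    have cq: "c * q ^ k < 1" for k
      using mult_left_le[OF power_le_one[of q k] c(1)] q c by simp
    define A where "A = q_shifted_factorial (a * q) q m"
    define B where "B = q_shifted_factorial (b * q) q m"
    define C where "C = q_shifted_factorial (c * q * q) q m"
    define Q where "Q = q_shifted_factorial q q m"
    define y where "y = q ^ m"
    have "q * y < 1" using q by (simp add: y_def power_Suc_less_one flip: power_Suc)
    then have pos: "C > 0" "Q > 0" "1 - q * y > 0" "1 - c * q > 0" "1 - c > 0" "1 - c * q * y > 0"
      using q_shifted_factorial_pos[OF q, of "c * q * q" m] q_shifted_factorial_pos[OF q, of q m]
        cq[of 1] cq[of 2] cq[of "Suc m"] c q
      by (simp_all add: C_def Q_def y_def power2_eq_square mult.assoc)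
    \<comment> \<open>compare the two ways of splitting a factor off \<open>(c q; q)\<^sub>m\<^sub>+\<^sub>1\<close>\<close>
    have cq_fac: "q_shifted_factorial (c * q) q m = (1 - c * q) * C / (1 - c * q * y)"
      using q_shifted_factorial_Suc[of "c * q" q m] q_shifted_factorial_Suc_left[of "c * q" q m] pos
      by (simp add: C_def y_def field_simps)
    have lhs: "fps_nth (heine_fps q a b c) (Suc m)
        = (1 - a) * A * ((1 - b) * B) / ((1 - c) * ((1 - c * q) * C / (1 - c * q * y)) * (Q * (1 - q * y))) * (q * y)"
      by (simp add: heine_fps_def q_shifted_factorial_Suc_left[of a] q_shifted_factorial_Suc_left[of b]
          q_shifted_factorial_Suc_left[of c] q_shifted_factorial_Suc[of q] cq_fac A_def B_def Q_def y_def)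
    have rhs1: "fps_nth (heine_fps q a (b * q) (c * q)) (Suc m)
        = (1 - a) * A * (B * (1 - b * q * y)) / ((1 - c * q) * C * (Q * (1 - q * y))) * (q * y)"
      by (simp add: heine_fps_def q_shifted_factorial_Suc_left[of a] q_shifted_factorial_Suc[of "b * q"]
          q_shifted_factorial_Suc_left[of "c * q"] q_shifted_factorial_Suc[of q] A_def B_def C_def Q_def y_def)
    have rhs2: "fps_nth (heine_fps q (a * q) (b * q) (c * q * q)) m = A * B / (C * Q) * y"
      by (simp add: heine_fps_def A_def B_def C_def Q_def y_def)
    have "fps_nth (heine_fps q a (b * q) (c * q) - fps_const ((1 - a) / (1 - c) * (q * (b - c) / (1 - c * q))) * fps_X
        * heine_fps q (a * q) (b * q) (c * q * q)) (Suc m)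
      = fps_nth (heine_fps q a (b * q) (c * q)) (Suc m)
        - (1 - a) / (1 - c) * (q * (b - c) / (1 - c * q)) * fps_nth (heine_fps q (a * q) (b * q) (c * q * q)) m"
      by (simp add: mult.assoc)
    also have "\<dots> = fps_nth (heine_fps q a b c) (Suc m)"
    proof -
      define u where "u = 1 - c"
      define v where "v = 1 - c * q"
      define w where "w = 1 - c * q * y"
      define r where "r = 1 - q * y"
      have nz: "u \<noteq> 0" "v \<noteq> 0" "w \<noteq> 0" "r \<noteq> 0" "C \<noteq> 0" "Q \<noteq> 0"
        using pos by (simp_all add: u_def v_def w_def r_def)
      have key: "(1 - b * q * y) * u - (b - c) * r = (1 - b) * w"
        by (simp add: u_def w_def r_def algebra_simps)
      have "(1 - a) * A * (B * (1 - b * q * y)) / (v * C * (Q * r)) * (q * y)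
          - (1 - a) / u * (q * (b - c) / v) * (A * B / (C * Q) * y)
        = (1 - a) * A * B * q * y / (u * v * C * Q * r) * ((1 - b * q * y) * u - (b - c) * r)"
        using nz by (simp add: field_simps)
      also have "\<dots> = (1 - a) * A * ((1 - b) * B) / (u * (v * C / w) * (Q * r)) * (q * y)"
        unfolding key using nz by (simp add: field_simps)
      finally show ?thesis unfolding lhs rhs1 rhs2 u_def v_def w_def r_def .
    qed
    finally show ?thesis by (simp add: Suc)
  qed
qed

text \<open>
  A bound independent of \<open>n\<close>, from \<open>1 - y \<ge> exp (- y/(1 - y))\<close> and the geometric series. It
  keeps the denominators of Heine's series away from 0.
\<close>
lemma q_shifted_factorial_lower_bound:
  fixes x q :: real
  assumes q: "0 < q" "q < 1" and x: "0 \<le> x" "x \<le> x0" "x0 < 1"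
  shows "exp (- (x0 / ((1 - x0) * (1 - q)))) \<le> q_shifted_factorial x q n"
proof -
  have "exp (- (x0 / (1 - x0) * (\<Sum>k<n. q ^ k))) = (\<Prod>k<n. exp (- (x0 * q ^ k / (1 - x0))))"
    by (simp add: exp_sum[symmetric] sum_negf sum_distrib_left)
  also have "\<dots> \<le> q_shifted_factorial x q n"
    unfolding q_shifted_factorial_def
  proof (rule prod_mono, safe)
    fix k
    let ?y = "x0 * q ^ k"
    have qk: "0 < q ^ k" "q ^ k \<le> 1" using q by (auto simp: power_le_one)
    have y: "0 \<le> ?y" "?y \<le> x0" "x * q ^ k \<le> ?y"
      using x qk by (auto simp: mult_left_le mult_right_mono)
    have "1 / (1 - ?y) = 1 + ?y / (1 - ?y)" using y x by (simp add: field_simps)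
    also have "\<dots> \<le> 1 + ?y / (1 - x0)" using y x by (intro add_left_mono divide_left_mono) auto
    also have "\<dots> \<le> exp (?y / (1 - x0))" by (rule exp_ge_add_one_self)
    finally have "exp (- (?y / (1 - x0))) \<le> 1 - ?y"
      using y x by (simp add: exp_minus field_simps)
    then show "exp (- (?y / (1 - x0))) \<le> 1 - x * q ^ k" using y by linarith
  qed simp
  finally have "exp (- (x0 / (1 - x0) * (\<Sum>k<n. q ^ k))) \<le> q_shifted_factorial x q n" .
  moreover have "x0 / (1 - x0) * (\<Sum>k<n. q ^ k) \<le> x0 / (1 - x0) * (1 / (1 - q))"
  proof (rule mult_left_mono)
    show "(\<Sum>k<n. q ^ k) \<le> 1 / (1 - q)"
      using sum_le_suminf[OF summable_geometric, of q "{..<n}"] suminf_geometric[of q] q by simp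
  qed (use x in auto)
  then have "exp (- (x0 / ((1 - x0) * (1 - q)))) \<le> exp (- (x0 / (1 - x0) * (\<Sum>k<n. q ^ k)))"
    by simp
  ultimately show ?thesis by linarith
qed

lemma q_shifted_factorial_unit_interval:
  fixes x q :: real
  assumes "0 < q" "q < 1" "0 \<le> x" "x \<le> 1"
  shows "0 \<le> q_shifted_factorial x q n \<and> q_shifted_factorial x q n \<le> 1"
proof -
  have "0 \<le> 1 - x * q ^ k \<and> 1 - x * q ^ k \<le> 1" for k
    using assms mult_le_one[of x "q ^ k"] by (auto simp: power_le_one)
  then show ?thesis unfolding q_shifted_factorial_def by (auto intro!: prod_nonneg prod_le_1)
qed

text \<open>
  Here \<open>x\<close> may exceed 1, but then only the first factor \<open>1 - x\<close> can be negative or large.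
\<close>
lemma q_shifted_factorial_abs_bound:
  fixes x q :: real
  assumes q: "0 < q" "q < 1" and x: "0 \<le> x" "x * q \<le> 1"
  shows "\<bar>q_shifted_factorial x q n\<bar> \<le> 1 / q"
proof (cases n)
  case 0
  then show ?thesis using q by simp
next
  case (Suc m)
  have "x \<le> 1 / q" using q x by (simp add: field_simps)
  moreover have "1 \<le> 1 / q" using q by simp
  ultimately have "\<bar>1 - x\<bar> \<le> 1 / q" using x by linarith
  moreover have "0 \<le> q_shifted_factorial (x * q) q m" "q_shifted_factorial (x * q) q m \<le> 1"
    using q_shifted_factorial_unit_interval[OF q, of "x * q" m] q x by auto
  ultimately have "\<bar>1 - x\<bar> * \<bar>q_shifted_factorial (x * q) q m\<bar> \<le> 1 / q * 1"
    using q by (intro mult_mono) auto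
  then show ?thesis by (simp add: Suc q_shifted_factorial_Suc_left abs_mult)
qed

definition heine_bound :: "real \<Rightarrow> real \<Rightarrow> real" where
  "heine_bound q c = 1 / q / (exp (- (c / ((1 - c) * (1 - q)))) * exp (- (q / ((1 - q) * (1 - q)))))"

lemma heine_fps_coeff_bound:
  assumes q: "0 < q" "q < 1" and a: "0 \<le> a" "a \<le> 1" and b: "0 \<le> b" "b * q \<le> 1"
    and c: "0 \<le> c" "c \<le> c0" "c0 < 1"
  shows "\<bar>fps_nth (heine_fps q a b c) n\<bar> \<le> heine_bound q c0 * q ^ n"
proof -
  have "\<bar>q_shifted_factorial a q n\<bar> * \<bar>q_shifted_factorial b q n\<bar> \<le> 1 * (1 / q)"
    using q_shifted_factorial_unit_interval[OF q a, of n] q_shifted_factorial_abs_bound[OF q b, of n]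
    by (intro mult_mono) auto
  moreover have "exp (- (c0 / ((1 - c0) * (1 - q)))) * exp (- (q / ((1 - q) * (1 - q))))
     \<le> q_shifted_factorial c q n * q_shifted_factorial q q n"
    using q c q_shifted_factorial_pos[OF q]
    by (intro mult_mono q_shifted_factorial_lower_bound) (auto intro!: less_imp_le)
  ultimately have "\<bar>q_shifted_factorial a q n * q_shifted_factorial b q n\<bar>
      / (q_shifted_factorial c q n * q_shifted_factorial q q n) \<le> heine_bound q c0"
    unfolding heine_bound_def using q by (intro frac_le) (auto simp: abs_mult)
  moreover have "q_shifted_factorial c q n > 0" "q_shifted_factorial q q n > 0"
    using q_shifted_factorial_pos[OF q] q c by auto
  moreover have "\<bar>fps_nth (heine_fps q a b c) n\<bar> = \<bar>q_shifted_factorial a q n * q_shifted_factorial b q n\<bar>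
      / (q_shifted_factorial c q n * q_shifted_factorial q q n) * q ^ n"
    using calculation(2,3) q by (simp add: heine_fps_def abs_mult)
  ultimately show ?thesis using q by (simp only: mult_right_mono zero_le_power less_imp_le)
qed

lemma q_shifted_factorial_of_real:
  "q_shifted_factorial (of_real x) (of_real q) n
    = (of_real (q_shifted_factorial x q n) :: 'a :: {real_algebra_1, comm_ring_1})"
  by (simp add: q_shifted_factorial_def)

lemma heine_Phi_eq_series:
  "heine_Phi (of_real a) (of_real b) (of_real c) (of_real q) (of_real q * z)
    = (\<Sum>n. of_real (fps_nth (heine_fps q a b c) n) * z ^ n)"
  by (simp add: heine_Phi_def q_shifted_factorial_of_real heine_fps_def power_mult_distrib mult.assoc)

text \<open>
  The parameter region of the main theorem together with its boundary part \<open>a = c\<close>. It is preserved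
  by the step of the continued fraction, and \<open>(a - c)/(1 - c)\<close> lies in the unit interval on it.
\<close>
definition admissible :: "real \<Rightarrow> real \<Rightarrow> real \<Rightarrow> real \<Rightarrow> bool" where
  "admissible q a b c \<longleftrightarrow> 0 \<le> c \<and> c < 1 \<and> c \<le> a \<and> a \<le> 1 \<and> c \<le> b \<and> b * q \<le> 1"

lemma admissible_step:
  assumes "0 < q" "q < 1" "admissible q a b c"
  shows "admissible q (b * q) a (c * q)"
proof -
  have "c * q \<le> c" "a * q \<le> a" using assms by (auto simp: admissible_def mult_left_le)
  then show ?thesis using assms by (auto simp: admissible_def)
qed

lemma heine_fps_summable:
  assumes q: "0 < q" "q < 1" and adm: "admissible q a b c" and z: "norm (z :: complex) < 1"
  shows "summable (\<lambda>n. norm (of_real (fps_nth (heine_fps q a b c) n) * z ^ n))"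
proof (rule summable_comparison_test)
  show "\<exists>N. \<forall>n\<ge>N. norm (norm (of_real (fps_nth (heine_fps q a b c) n) * z ^ n))
      \<le> heine_bound q c * q ^ n"
  proof (intro exI allI impI)
    fix n
    have "norm (z ^ n) \<le> 1" using z by (simp add: norm_power power_le_one)
    moreover have "\<bar>fps_nth (heine_fps q a b c) n\<bar> \<le> heine_bound q c * q ^ n"
      using q adm by (intro heine_fps_coeff_bound) (auto simp: admissible_def)
    ultimately have "\<bar>fps_nth (heine_fps q a b c) n\<bar> * norm (z ^ n) \<le> (heine_bound q c * q ^ n) * 1"
      by (intro mult_mono) auto
    then show "norm (norm (of_real (fps_nth (heine_fps q a b c) n) * z ^ n)) \<le> heine_bound q c * q ^ n"
      by (simp add: norm_mult)
  qed
  show "summable (\<lambda>n. heine_bound q c * q ^ n)" using q by (intro summable_mult summable_geometric) auto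
qed

text \<open>
  The parameters met along the continued fraction. Since Heine's function is symmetric in its first
  two parameters, exchanging them at each step turns the two alternating contiguous relations into
  a single one.
\<close>
definition contiguous_orbit :: "real \<Rightarrow> (nat \<Rightarrow> real) \<Rightarrow> (nat \<Rightarrow> real) \<Rightarrow> (nat \<Rightarrow> real) \<Rightarrow> bool" where
  "contiguous_orbit q A B C \<longleftrightarrow> (\<forall>k. A (Suc k) = B k * q \<and> B (Suc k) = A k \<and> C (Suc k) = C k * q
     \<and> admissible q (A k) (B k) (C k))"

lemma ex_contiguous_orbit:
  assumes q: "0 < q" "q < 1" and adm: "admissible q a b c"
  obtains A B C where "A 0 = a" "B 0 = b" "C 0 = c" "contiguous_orbit q A B C"
proof -
  define p where "p k = ((\<lambda>(a, b, c). (b * q, a, c * q)) ^^ k) (a, b, c)" for k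
  define A B C where "A k = fst (p k)" and "B k = fst (snd (p k))" and "C k = snd (snd (p k))" for k
  have p0: "A 0 = a" "B 0 = b" "C 0 = c" by (simp_all add: A_def B_def C_def p_def)
  have step: "A (Suc k) = B k * q" "B (Suc k) = A k" "C (Suc k) = C k * q" for k
    by (simp_all add: A_def B_def C_def p_def case_prod_beta)
  have "admissible q (A k) (B k) (C k)" for k
    by (induction k) (simp_all add: p0 adm step admissible_step q)
  then have "contiguous_orbit q A B C" by (simp add: contiguous_orbit_def step)
  then show ?thesis by (rule that[of A B C, OF p0])
qed

lemma contiguous_orbit_tendsto:
  assumes q: "0 < q" "q < 1" and orbit: "contiguous_orbit q A B C"
  shows "A \<longlonglongrightarrow> 0" "B \<longlonglongrightarrow> 0" "C \<longlonglongrightarrow> 0" "C k \<le> C 0"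
proof -
  have step: "A (Suc k) = B k * q" "B (Suc k) = A k" "C (Suc k) = C k * q"
    and ad: "admissible q (A k) (B k) (C k)" for k
    using orbit by (auto simp: contiguous_orbit_def)
  have C: "C k = C 0 * q ^ k" for k by (induction k) (simp_all add: step)
  define r where "r = sqrt q"
  have r: "0 < r" "r < 1" "r * r = q" using q by (simp_all add: r_def)
  \<comment> \<open>Two steps multiply by \<open>q\<close>, so one step should cost a factor \<open>r = sqrt q\<close>; weighting the
    second parameter by \<open>r\<close> makes this exact.\<close>
  have AB: "A k \<le> 1 / q * r ^ k \<and> r * B k \<le> 1 / q * r ^ k" for k
  proof (induction k)
    case 0
    have "0 \<le> B 0" "B 0 \<le> 1 / q" "A 0 \<le> 1" "1 \<le> 1 / q"
      using ad[of 0] q by (auto simp: admissible_def field_simps)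
    moreover have "r * B 0 \<le> B 0" using calculation(1) r by (simp add: mult_left_le_one_le)
    ultimately show ?case by simp
  next
    case (Suc k)
    have "A (Suc k) = r * (r * B k)" by (simp add: step r(3)[symmetric])
    also have "\<dots> \<le> r * (1 / q * r ^ k)" using Suc r by (intro mult_left_mono) auto
    finally have "A (Suc k) \<le> 1 / q * r ^ Suc k" by simp
    moreover have "r * B (Suc k) \<le> r * (1 / q * r ^ k)"
      unfolding step using Suc r by (intro mult_left_mono) auto
    ultimately show ?case by simp
  qed
  have nn: "0 \<le> A k" "0 \<le> B k" for k using ad[of k] by (auto simp: admissible_def)
  have lim: "(\<lambda>k. M * r ^ k) \<longlonglongrightarrow> 0" for M
    using r by (intro tendsto_mult_right_zero LIMSEQ_realpow_zero) auto
  show "A \<longlonglongrightarrow> 0"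
    by (rule tendsto_sandwich[OF _ _ tendsto_const lim[of "1 / q"]]) (use AB nn in auto)
  show "B \<longlonglongrightarrow> 0"
  proof (rule tendsto_sandwich[OF _ _ tendsto_const lim[of "1 / q / r"]])
    have "B k \<le> 1 / q / r * r ^ k" for k
      using divide_right_mono[of "r * B k" "1 / q * r ^ k" r] AB[of k] r(1) by simp
    then show "\<forall>\<^sub>F k in sequentially. B k \<le> 1 / q / r * r ^ k" by simp
  qed (use nn in auto)
  have "(\<lambda>k. C 0 * q ^ k) \<longlonglongrightarrow> 0"
    using q by (intro tendsto_mult_right_zero LIMSEQ_realpow_zero) auto
  then show "C \<longlonglongrightarrow> 0" by (simp only: C[symmetric])
  show "C k \<le> C 0"
    unfolding C[of k] using ad[of 0] q by (auto simp: admissible_def power_le_one mult_left_le)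
qed

text \<open>
  With \<open>g\<^sub>k = (A\<^sub>k - C\<^sub>k)/(1 - C\<^sub>k)\<close> along the orbit, the contiguous relation has the coefficients
  \<open>(1 - g\<^sub>k) g\<^sub>k\<^sub>+\<^sub>1\<close> of a chain sequence.
\<close>
lemma heine_ratio_fps:
  assumes q: "0 < q" "q < 1" and adm: "admissible q a b c"
  obtains s where "completely_monotone s" "s 0 = 1"
    "Abs_fps s * heine_fps q a b c = heine_fps q a (b * q) (c * q)"
proof -
  obtain A B C where p0: "A 0 = a" "B 0 = b" "C 0 = c" and orbit: "contiguous_orbit q A B C"
    using ex_contiguous_orbit[OF q adm] by blast
  have step: "A (Suc k) = B k * q" "B (Suc k) = A k" "C (Suc k) = C k * q"
    and ad: "admissible q (A k) (B k) (C k)" for k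
    using orbit by (auto simp: contiguous_orbit_def)
  define g where "g k = (A k - C k) / (1 - C k)" for k
  define P where "P k = heine_fps q (A k) (B k) (C k)" for k
  have g: "0 \<le> g k \<and> g k \<le> 1" for k
    using ad[of k] by (simp add: g_def admissible_def divide_simps)
  have "P k = P (Suc k) - fps_const ((1 - g k) * g (Suc k)) * fps_X * P (Suc (Suc k))" for k
  proof -
    have "1 - g k = (1 - A k) / (1 - C k)" using ad[of k] by (simp add: g_def admissible_def field_simps)
    moreover have "g (Suc k) = q * (B k - C k) / (1 - C k * q)"
      by (simp add: g_def step algebra_simps)
    ultimately show ?thesis
      using heine_fps_contiguous[OF q, of "C k" "A k" "B k"] ad[of k]
      by (simp add: P_def step admissible_def heine_fps_commute[of q "B k * q" "A k"] mult.assoc)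
  qed
  then have "Abs_fps (\<lambda>n. jacobi_vec g (2 * n) 0) * P 0 = P 1"
    by (rule jacobi_fps[OF g])
  then have "Abs_fps (\<lambda>n. jacobi_vec g (2 * n) 0) * heine_fps q a b c = heine_fps q a (b * q) (c * q)"
    by (simp add: P_def p0 step heine_fps_commute[of q "b * q" a])
  then show ?thesis
    using that[OF completely_monotone_jacobi[OF g]] by (simp add: jacobi_vec_0)
qed

lemma heine_ratio_product:
  assumes q: "0 < q" "q < 1" and adm: "admissible q a b c"
  obtains s where "completely_monotone s" "s 0 = 1"
    "\<forall>z :: complex. norm z < 1 \<longrightarrow>
      (\<Sum>n. of_real (s n) * z ^ n) * (\<Sum>n. of_real (fps_nth (heine_fps q a b c) n) * z ^ n)
        = (\<Sum>n. of_real (fps_nth (heine_fps q a (b * q) (c * q)) n) * z ^ n)"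
proof -
  obtain s where s: "completely_monotone s" "s 0 = 1"
    "Abs_fps s * heine_fps q a b c = heine_fps q a (b * q) (c * q)"
    using heine_ratio_fps[OF q adm] by blast
  have "(\<Sum>n. of_real (s n) * z ^ n) * (\<Sum>n. of_real (fps_nth (heine_fps q a b c) n) * z ^ n)
        = (\<Sum>n. of_real (fps_nth (heine_fps q a (b * q) (c * q)) n) * z ^ n)"
    if z: "norm z < 1" for z :: complex
  proof -
    have "summable (\<lambda>n. norm (of_real (s n) * z ^ n))"
    proof (rule summable_comparison_test)
      show "\<exists>N. \<forall>n\<ge>N. norm (norm (of_real (s n) * z ^ n)) \<le> norm z ^ n"
        using completely_monotone_bounds[OF s(1)] s(2)
        by (auto simp: norm_mult norm_power mult_left_le_one_le)
      show "summable (\<lambda>n. norm z ^ n)" using z by (simp add: summable_geometric)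
    qed
    then have "(\<Sum>n. of_real (s n) * z ^ n) * (\<Sum>n. of_real (fps_nth (heine_fps q a b c) n) * z ^ n)
       = (\<Sum>n. \<Sum>i\<le>n. (of_real (s i) * z ^ i) * (of_real (fps_nth (heine_fps q a b c) (n - i)) * z ^ (n - i)))"
      by (rule Cauchy_product) (rule heine_fps_summable[OF q adm z])
    also have "\<dots> = (\<Sum>n. of_real (fps_nth (Abs_fps s * heine_fps q a b c) n) * z ^ n)"
    proof (rule arg_cong[where f = suminf], rule ext)
      fix n
      have "(\<Sum>i\<le>n. (of_real (s i) * z ^ i) * (of_real (fps_nth (heine_fps q a b c) (n - i)) * z ^ (n - i)))
        = (\<Sum>i\<le>n. of_real (s i * fps_nth (heine_fps q a b c) (n - i)) * z ^ n)"
        by (intro sum.cong refl) (auto simp: power_add[symmetric] mult_ac)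
      then show "(\<Sum>i\<le>n. (of_real (s i) * z ^ i) * (of_real (fps_nth (heine_fps q a b c) (n - i)) * z ^ (n - i)))
        = of_real (fps_nth (Abs_fps s * heine_fps q a b c) n) * z ^ n"
        by (simp add: fps_mult_nth atLeast0AtMost sum_distrib_right)
    qed
    finally show ?thesis by (simp add: s(3))
  qed
  then show ?thesis using that[OF s(1,2)] by blast
qed

text \<open>
  The function \<open>e y = \<Sum> y^n/(q;q)\<^sub>n\<close> satisfies \<open>e (q y) = (1 - y) e y\<close>. A zero \<open>y\<close> would therefore
  produce the zeros \<open>q^m y\<close>, which tend to 0, although \<open>e 0 = 1\<close>.
\<close>
lemma q_exponential_nonzero:
  fixes y :: complex
  assumes q: "0 < q" "q < 1" and y: "norm y < 1"
  shows "(\<Sum>n. of_real (1 / q_shifted_factorial q q n) * y ^ n) \<noteq> 0"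
proof
  define e where "e y = (\<Sum>n. of_real (1 / q_shifted_factorial q q n) * y ^ n)" for y :: complex
  define M where "M = 1 / exp (- (q / ((1 - q) * (1 - q))))"
  have pos: "q_shifted_factorial q q n > 0" for n using q_shifted_factorial_pos[OF q] q by simp
  have M: "1 / q_shifted_factorial q q n \<le> M" for n
    unfolding M_def using q pos[of n]
    by (intro divide_left_mono q_shifted_factorial_lower_bound) (auto intro!: mult_pos_pos)
  have summ: "summable (\<lambda>n. of_real (1 / q_shifted_factorial q q n) * y ^ n)" if "norm y < 1" for y :: complex
  proof (rule summable_comparison_test)
    show "\<exists>N. \<forall>n\<ge>N. norm (of_real (1 / q_shifted_factorial q q n) * y ^ n) \<le> M * norm y ^ n"
    proof (intro exI allI impI)
      fix n
      have "\<bar>1 / q_shifted_factorial q q n\<bar> \<le> M" using M[of n] pos[of n] by simp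
      then show "norm (of_real (1 / q_shifted_factorial q q n) * y ^ n) \<le> M * norm y ^ n"
        unfolding norm_mult norm_power norm_of_real by (rule mult_right_mono) simp
    qed
    show "summable (\<lambda>n. M * norm y ^ n)"
      using that by (intro summable_mult summable_geometric) auto
  qed
  have norm_qy: "norm (of_real q * y) < 1" if "norm y < 1" for y :: complex
    using that q mult_left_le_one_le[of "norm y" q] by (simp add: norm_mult)
  have step: "e (of_real q * y) = (1 - y) * e y" if "norm y < 1" for y
  proof -
    have "e y - e (of_real q * y)
        = (\<Sum>n. of_real ((1 - q ^ n) / q_shifted_factorial q q n) * y ^ n)"
      unfolding e_def
      by (subst suminf_diff[OF summ summ]) (use that norm_qy in
        \<open>auto simp: power_mult_distrib diff_divide_distrib left_diff_distrib\<close>)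
    also have "\<dots> = (\<Sum>n. of_real ((1 - q ^ Suc n) / q_shifted_factorial q q (Suc n)) * y ^ Suc n)"
    proof (subst suminf_split_head)
      have "summable (\<lambda>n. of_real (1 / q_shifted_factorial q q n) * y ^ n
          - of_real (1 / q_shifted_factorial q q n) * (of_real q * y) ^ n)"
        using that norm_qy by (intro summable_diff summ)
      then show "summable (\<lambda>n. of_real ((1 - q ^ n) / q_shifted_factorial q q n) * y ^ n)"
        by (simp add: power_mult_distrib diff_divide_distrib left_diff_distrib)
    qed simp
    also have "\<dots> = (\<Sum>n. y * (of_real (1 / q_shifted_factorial q q n) * y ^ n))"
    proof (rule arg_cong[where f = suminf], rule ext)
      fix n
      have "1 - q ^ Suc n > 0" using q by (simp add: power_Suc_less_one del: power_Suc)
      then have "(1 - q ^ Suc n) / q_shifted_factorial q q (Suc n) = 1 / q_shifted_factorial q q n"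
        by (simp add: q_shifted_factorial_Suc)
      then show "of_real ((1 - q ^ Suc n) / q_shifted_factorial q q (Suc n)) * y ^ Suc n
        = y * (of_real (1 / q_shifted_factorial q q n) * y ^ n)" by simp
    qed
    also have "\<dots> = y * e y" unfolding e_def by (rule suminf_mult[OF summ[OF that]])
    finally show ?thesis by (simp add: algebra_simps)
  qed
  assume "(\<Sum>n. of_real (1 / q_shifted_factorial q q n) * y ^ n) = 0"
  then have "e y = 0" by (simp add: e_def)
  have "norm (of_real (q ^ m) * y) < 1 \<and> e (of_real (q ^ m) * y) = 0" for m
  proof (induction m)
    case (Suc m)
    then show ?case using step[of "of_real (q ^ m) * y"] norm_qy[of "of_real (q ^ m) * y"]
      by (simp add: mult.assoc)
  qed (use y \<open>e y = 0\<close> in simp)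
  moreover have "(\<lambda>m. e (of_real (q ^ m) * y)) \<longlonglongrightarrow> e 0"
  proof (rule isCont_tendsto_compose[of 0 e])
    have "summable (\<lambda>n. of_real (1 / q_shifted_factorial q q n) * (1 / 2 :: complex) ^ n)"
      by (rule summ) simp
    then show "isCont e 0" unfolding e_def[abs_def] by (rule isCont_powser) simp
    have "(\<lambda>m. of_real (q ^ m) * y) \<longlonglongrightarrow> of_real 0 * y"
      using q by (intro tendsto_intros LIMSEQ_realpow_zero) auto
    then show "(\<lambda>m. of_real (q ^ m) * y) \<longlonglongrightarrow> 0" by simp
  qed
  ultimately have "e 0 = 0" by (simp add: LIMSEQ_const_iff)
  moreover have "e 0 = 1" unfolding e_def powser_zero by simp
  ultimately show False by simp
qed

text \<open>
  All three parameters tend to 0, and the coefficient bound is uniform along the orbit, so that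
  Tannery's theorem applies.
\<close>
lemma heine_orbit_tendsto_q_exponential:
  fixes z :: complex
  assumes q: "0 < q" "q < 1" and z: "norm z < 1"
    and ad: "\<And>k. admissible q (A k) (B k) (C k)" and C: "\<And>k. C k \<le> c" "c < 1"
    and lim: "A \<longlonglongrightarrow> 0" "B \<longlonglongrightarrow> 0" "C \<longlonglongrightarrow> 0"
  shows "(\<lambda>k. \<Sum>n. of_real (fps_nth (heine_fps q (A k) (B k) (C k)) n) * z ^ n)
    \<longlonglongrightarrow> (\<Sum>n. of_real (1 / q_shifted_factorial q q n) * (of_real q * z) ^ n)"
proof -
  have fac: "(\<lambda>k. q_shifted_factorial (X k) q n) \<longlonglongrightarrow> 1" if "X \<longlonglongrightarrow> 0" for X n
  proof -
    have "(\<lambda>k. q_shifted_factorial (X k) q n) \<longlonglongrightarrow> (\<Prod>i<n. 1 - 0 * q ^ i)"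
      unfolding q_shifted_factorial_def by (intro tendsto_intros that)
    then show ?thesis by simp
  qed
  have pos: "q_shifted_factorial q q n > 0" for n using q_shifted_factorial_pos[OF q] q by simp
  have coeff: "(\<lambda>k. of_real (fps_nth (heine_fps q (A k) (B k) (C k)) n) * z ^ n)
      \<longlonglongrightarrow> of_real (1 / q_shifted_factorial q q n) * (of_real q * z) ^ n" for n
  proof -
    have "(\<lambda>k. fps_nth (heine_fps q (A k) (B k) (C k)) n)
        \<longlonglongrightarrow> 1 * 1 / (1 * q_shifted_factorial q q n) * q ^ n"
      unfolding heine_fps_def fps_nth_Abs_fps
      by (intro tendsto_intros fac lim) (use pos[of n] in auto)
    then have "(\<lambda>k. of_real (fps_nth (heine_fps q (A k) (B k) (C k)) n) * z ^ n)
        \<longlonglongrightarrow> of_real (1 * 1 / (1 * q_shifted_factorial q q n) * q ^ n) * z ^ n"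
      by (intro tendsto_intros)
    then show ?thesis by (simp add: power_mult_distrib)
  qed
  have "norm (of_real (fps_nth (heine_fps q (A k) (B k) (C k)) n) * z ^ n) \<le> heine_bound q c * q ^ n" for k n
  proof -
    have "\<bar>fps_nth (heine_fps q (A k) (B k) (C k)) n\<bar> \<le> heine_bound q c * q ^ n"
      using q ad[of k] C(1)[of k] C(2) by (intro heine_fps_coeff_bound) (auto simp: admissible_def)
    moreover have "norm (z ^ n) \<le> 1" using z by (simp add: norm_power power_le_one)
    ultimately have "\<bar>fps_nth (heine_fps q (A k) (B k) (C k)) n\<bar> * norm (z ^ n) \<le> heine_bound q c * q ^ n * 1"
      by (intro mult_mono) auto
    then show ?thesis by (simp add: norm_mult)
  qed
  moreover have "summable (\<lambda>n. heine_bound q c * q ^ n)"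
    using q by (intro summable_mult summable_geometric) auto
  ultimately show ?thesis
    by (intro tannerys_theorem[where M = "\<lambda>n. heine_bound q c * q ^ n", THEN conjunct2, THEN conjunct2] coeff)
      (simp_all add: always_eventually)
qed

text \<open>
  Every quotient of consecutive series along the orbit is a convergent power series in the disk, so
  a zero of one series is a zero of the next, and hence of the limit.
\<close>
lemma heine_series_nonzero:
  fixes z :: complex
  assumes q: "0 < q" "q < 1" and adm: "admissible q a b c" and z: "norm z < 1"
  shows "(\<Sum>n. of_real (fps_nth (heine_fps q a b c) n) * z ^ n) \<noteq> 0"
proof
  obtain A B C where p0: "A 0 = a" "B 0 = b" "C 0 = c" and orbit: "contiguous_orbit q A B C"
    using ex_contiguous_orbit[OF q adm] by blast
  have step: "A (Suc k) = B k * q" "B (Suc k) = A k" "C (Suc k) = C k * q"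
    and ad: "admissible q (A k) (B k) (C k)" for k
    using orbit by (auto simp: contiguous_orbit_def)
  define S where "S k = (\<Sum>n. of_real (fps_nth (heine_fps q (A k) (B k) (C k)) n) * z ^ n)" for k
  assume "(\<Sum>n. of_real (fps_nth (heine_fps q a b c) n) * z ^ n) = 0"
  then have "S 0 = 0" by (simp add: S_def p0)
  have "S (Suc k) = 0" if "S k = 0" for k
  proof -
    obtain s where "completely_monotone s" "s 0 = 1" and prod: "\<forall>z :: complex. norm z < 1 \<longrightarrow>
      (\<Sum>n. of_real (s n) * z ^ n) * (\<Sum>n. of_real (fps_nth (heine_fps q (A k) (B k) (C k)) n) * z ^ n)
        = (\<Sum>n. of_real (fps_nth (heine_fps q (A k) (B k * q) (C k * q)) n) * z ^ n)"
      using heine_ratio_product[OF q ad[of k]] by blast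
    from prod[rule_format, OF z] show ?thesis
      using that unfolding S_def step by (simp add: heine_fps_commute[of q "B k * q" "A k"])
  qed
  then have "S k = 0" for k using \<open>S 0 = 0\<close> by (induction k) auto
  moreover have "S \<longlonglongrightarrow> (\<Sum>n. of_real (1 / q_shifted_factorial q q n) * (of_real q * z) ^ n)"
    unfolding S_def using adm contiguous_orbit_tendsto[OF q orbit]
    by (intro heine_orbit_tendsto_q_exponential[OF q z ad, where c = c]) (auto simp: admissible_def p0)
  moreover have "S = (\<lambda>_. 0)" using calculation(1) by blast
  ultimately have "(\<Sum>n. of_real (1 / q_shifted_factorial q q n) * (of_real q * z) ^ n) = 0"
    using LIMSEQ_unique tendsto_const by blast
  moreover have "norm (of_real q * z) < 1"
    using z q mult_left_le_one_le[of "norm z" q] by (simp add: norm_mult)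
  ultimately show False using q_exponential_nonzero[OF q] by blast
qed

section \<open>Cauchy transforms of distributions on the unit interval\<close>

lemma cut_plane_nz:
  assumes "z \<in> cut_plane" "t \<in> {0..1}"
  shows "1 - of_real t * z \<noteq> 0"
proof
  assume eq: "1 - of_real t * z = 0"
  then have "1 - t * Re z = 0" "t * Im z = 0"
    by (auto simp: complex_eq_iff)
  then have "t \<noteq> 0" "t * Re z = 1" "Im z = 0" by auto
  moreover have "t > 0" "t \<le> 1" using assms(2) \<open>t \<noteq> 0\<close> by auto
  ultimately have "Re z \<ge> 1" by (metis mult_le_cancel_left_pos mult.right_neutral)
  with \<open>Im z = 0\<close> assms(1) show False by (simp add: cut_plane_def)
qed

lemma open_cut_plane: "open cut_plane"
proof -
  have "closed {z :: complex. Im z = 0 \<and> 1 \<le> Re z}"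
    by (intro closed_Collect_conj closed_Collect_eq closed_Collect_le continuous_intros)
  then show ?thesis unfolding cut_plane_def by (simp add: open_Compl)
qed

lemma half_plane_cut_plane: "Re z < 1 \<Longrightarrow> z \<in> cut_plane"
  by (auto simp: cut_plane_def)

lemma ball_half_plane: "z \<in> ball 0 1 \<Longrightarrow> Re z < 1"
  using complex_Re_le_cmod[of z] by simp

lemma kernel_cont:
  assumes "z \<in> cut_plane"
  shows "continuous_on {0..1} (\<lambda>t. z / (1 - of_real t * z))"
  by (intro continuous_intros) (use cut_plane_nz[OF assms] in auto)

lemma kernel2_cont:
  assumes "z \<in> cut_plane" "w \<in> cut_plane"
  shows "continuous_on {0..1} (\<lambda>t. 1 / ((1 - of_real t * z) * (1 - of_real t * w)))"
  by (intro continuous_intros) (use cut_plane_nz assms in auto)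

text \<open>
  The properties of \<open>F z = \<integral> z/(1 - t z) d\<mu>(t)\<close> use the integral only as a positive linear functional
  \<open>E\<close> of total mass 1 on the continuous functions.
\<close>
locale stieltjes_distribution =
  fixes \<mu> :: "real \<Rightarrow> real"
  assumes mono: "mono_on {0..1} \<mu>" and mass: "\<mu> 1 - \<mu> 0 = 1"
    and integrable: "continuous_on {0..1} f \<Longrightarrow> stieltjes_integrable (f :: real \<Rightarrow> complex) \<mu> 0 1"
begin

definition E :: "(real \<Rightarrow> complex) \<Rightarrow> complex" where
  "E f = stieltjes_integral f \<mu> 0 1"

lemma has_E: "continuous_on {0..1} f \<Longrightarrow> has_stieltjes_integral f \<mu> 0 1 (E f)"
  unfolding E_def by (intro stieltjes_integrable_has integrable)

lemma E_eqI: "has_stieltjes_integral f \<mu> 0 1 I \<Longrightarrow> E f = I"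
  unfolding E_def by (rule stieltjes_integral_eq)

lemma E_cong:
  assumes "\<And>t. t \<in> {0..1} \<Longrightarrow> f t = g t"
  shows "E f = E g"
proof -
  have "has_stieltjes_integral f \<mu> 0 1 I \<longleftrightarrow> has_stieltjes_integral g \<mu> 0 1 I" for I
    using has_stieltjes_integral_cong[of 0 1 f g] has_stieltjes_integral_cong[of 0 1 g f] assms by auto
  then show ?thesis by (simp add: E_def stieltjes_integral_def)
qed

lemma E_linear:
  assumes "continuous_on {0..1} f" "bounded_linear h"
  shows "E (\<lambda>t. h (f t)) = h (E f)"
  by (rule E_eqI[OF has_stieltjes_integral_bounded_linear[OF has_E]]) (rule assms)+

lemma E_cmult: "continuous_on {0..1} f \<Longrightarrow> E (\<lambda>t. c * f t) = c * E f"
  by (rule E_linear) (auto intro: bounded_linear_mult_right)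

lemma E_diff:
  assumes "continuous_on {0..1} f" "continuous_on {0..1} g"
  shows "E (\<lambda>t. f t - g t) = E f - E g"
proof -
  have "has_stieltjes_integral (\<lambda>t. f t + - g t) \<mu> 0 1 (E f + - E g)"
    by (intro has_stieltjes_integral_add has_E assms
        has_stieltjes_integral_bounded_linear[OF has_E bounded_linear_minus[OF bounded_linear_ident]])
  then show ?thesis by (intro E_eqI) simp
qed

lemma E_norm_le:
  assumes "continuous_on {0..1} f" "\<And>t. t \<in> {0..1} \<Longrightarrow> norm (f t) \<le> B"
  shows "norm (E f) \<le> B"
  using has_stieltjes_integral_norm_bound[OF has_E[OF assms(1)] _ mono assms(2)] mass by simp

lemma E_Re_pos:
  assumes "continuous_on {0..1} f" "\<And>t. t \<in> {0..1} \<Longrightarrow> 0 < Re (f t)"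
  shows "0 < Re (E f)"
proof (rule has_stieltjes_integral_pos[where f = "\<lambda>t. Re (f t)"])
  show "has_stieltjes_integral (\<lambda>t. Re (f t)) \<mu> 0 1 (Re (E f))"
    by (rule has_stieltjes_integral_bounded_linear[OF has_E[OF assms(1)] bounded_linear_Re])
  show "continuous_on {0..1} (\<lambda>t. Re (f t))" by (intro continuous_intros assms)
qed (use mono mass assms in auto)

definition F :: "complex \<Rightarrow> complex" where
  "F z = E (\<lambda>t. z / (1 - of_real t * z))"

lemma F_diff:
  assumes z: "z \<in> cut_plane" and w: "w \<in> cut_plane"
  shows "F z - F w = (z - w) * E (\<lambda>t. 1 / ((1 - of_real t * z) * (1 - of_real t * w)))"
proof -
  have "F z - F w = E (\<lambda>t. z / (1 - of_real t * z) - w / (1 - of_real t * w))"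
    unfolding F_def by (rule E_diff[symmetric]) (intro kernel_cont z w)+
  also have "\<dots> = E (\<lambda>t. (z - w) * (1 / ((1 - of_real t * z) * (1 - of_real t * w))))"
  proof (rule E_cong)
    fix t :: real assume "t \<in> {0..1}"
    then show "z / (1 - of_real t * z) - w / (1 - of_real t * w)
       = (z - w) * (1 / ((1 - of_real t * z) * (1 - of_real t * w)))"
      using cut_plane_nz[OF z] cut_plane_nz[OF w]
      by (simp add: diff_frac_eq) (simp add: algebra_simps)
  qed
  also have "\<dots> = (z - w) * E (\<lambda>t. 1 / ((1 - of_real t * z) * (1 - of_real t * w)))"
    by (intro E_cmult kernel2_cont z w)
  finally show ?thesis .
qed

text \<open>
  By \<open>F_diff\<close> the difference quotient is an integral whose integrand converges uniformly in \<open>t\<close>,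
  because \<open>1 - t z\<close> is bounded away from 0 on the unit interval.
\<close>
lemma F_has_field_derivative:
  assumes z: "z \<in> cut_plane"
  shows "(F has_field_derivative E (\<lambda>t. 1 / ((1 - of_real t * z) * (1 - of_real t * z)))) (at z)"
proof -
  define k where "k w t = 1 / ((1 - of_real t * z) * (1 - of_real t * w))" for w and t :: real
  have "continuous_on {0..1} (\<lambda>t. norm (1 - of_real t * z))" by (intro continuous_intros)
  then obtain t0 where t0: "t0 \<in> {0..1}"
    "\<And>t. t \<in> {0..1} \<Longrightarrow> norm (1 - of_real t0 * z) \<le> norm (1 - of_real t * z)"
    using continuous_attains_inf[of "{0..1}" "\<lambda>t::real. norm (1 - of_real t * z)"] by auto
  define m where "m = norm (1 - of_real t0 * z)"
  have "m > 0" using cut_plane_nz[OF z t0(1)] by (simp add: m_def)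
  have m: "m \<le> norm (1 - of_real t * z)" if "t \<in> {0..1}" for t using t0(2) that by (simp add: m_def)
  have near: "\<forall>\<^sub>F w in at z. w \<in> cut_plane \<and> dist w z < m / 2"
    using \<open>m > 0\<close> eventually_at_in_open'[OF open_cut_plane z]
    by (intro eventually_conj) (auto simp: eventually_at intro!: exI[of _ "m / 2"])
  have bound: "norm (E (k w) - E (k z)) \<le> 2 / (m * m * m) * norm (w - z)"
    if w: "w \<in> cut_plane" "dist w z < m / 2" for w
  proof -
    have "E (k w) - E (k z) = E (\<lambda>t. k w t - k z t)"
      unfolding k_def by (rule E_diff[symmetric]) (intro kernel2_cont z w)+
    also have "norm \<dots> \<le> 2 / (m * m * m) * norm (w - z)"
    proof (rule E_norm_le)
      show "continuous_on {0..1} (\<lambda>t. k w t - k z t)"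
        unfolding k_def by (intro continuous_on_diff kernel2_cont z w)
      fix t :: real assume t: "t \<in> {0..1}"
      have nz: "1 - of_real t * z \<noteq> 0" "1 - of_real t * w \<noteq> 0"
        using cut_plane_nz z w t by blast+
      have eq: "k w t - k z t
          = of_real t * (w - z) / ((1 - of_real t * z) * (1 - of_real t * z) * (1 - of_real t * w))"
        unfolding k_def using nz by (simp add: divide_simps) (simp add: algebra_simps)
      have "norm (1 - of_real t * z) - norm (1 - of_real t * w) \<le> norm (of_real t * (w - z))"
        using norm_triangle_ineq2[of "1 - of_real t * z" "1 - of_real t * w"] by (simp add: algebra_simps)
      also have "\<dots> \<le> norm (w - z)" using t by (simp add: norm_mult mult_left_le_one_le)
      finally have mw: "m / 2 \<le> norm (1 - of_real t * w)"
        using m[OF t] w(2) by (simp add: dist_norm)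
      have "norm (k w t - k z t) \<le> norm (w - z) / (m * m * (m / 2))"
        unfolding eq norm_divide norm_mult
        using t mw m[OF t] \<open>m > 0\<close>
        by (intro frac_le mult_mono mult_nonneg_nonneg mult_pos_pos) (auto simp: mult_left_le_one_le)
      then show "norm (k w t - k z t) \<le> 2 / (m * m * m) * norm (w - z)" by (simp add: field_simps)
    qed
    finally show ?thesis .
  qed
  have "((\<lambda>w. E (k w) - E (k z)) \<longlongrightarrow> 0) (at z)"
  proof (rule Lim_null_comparison)
    show "\<forall>\<^sub>F w in at z. norm (E (k w) - E (k z)) \<le> 2 / (m * m * m) * norm (w - z)"
      using near by eventually_elim (use bound in blast)
    have "((\<lambda>w. 2 / (m * m * m) * norm (w - z)) \<longlongrightarrow> 2 / (m * m * m) * norm (z - z)) (at z)"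
      by (intro tendsto_intros)
    then show "((\<lambda>w. 2 / (m * m * m) * norm (w - z)) \<longlongrightarrow> 0) (at z)" by simp
  qed
  then have lim: "((\<lambda>w. E (k w)) \<longlongrightarrow> E (k z)) (at z)" by (rule LIM_zero_cancel)
  have "((\<lambda>w. (F w - F z) / (w - z)) \<longlongrightarrow> E (k z)) (at z)"
  proof (rule Lim_transform_eventually[OF lim])
    have "\<forall>\<^sub>F w in at z. w \<noteq> z" by (simp add: eventually_at_filter)
    with near show "\<forall>\<^sub>F w in at z. E (k w) = (F w - F z) / (w - z)"
    proof eventually_elim
      case (elim w)
      have "k w = (\<lambda>t. 1 / ((1 - of_real t * w) * (1 - of_real t * z)))"
        by (rule ext) (simp only: k_def mult.commute)
      then have "F w - F z = (w - z) * E (k w)" using F_diff[of w z] z elim by simp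
      then show ?case using elim by simp
    qed
  qed
  then show ?thesis unfolding has_field_derivative_iff k_def .
qed

lemma F_holomorphic: "F holomorphic_on cut_plane"
  using F_has_field_derivative by (meson holomorphic_on_open open_cut_plane)

lemma F_cnj:
  assumes "z \<in> cut_plane"
  shows "F (cnj z) = cnj (F z)"
proof -
  have "cnj (F z) = E (\<lambda>t. cnj (z / (1 - of_real t * z)))"
    unfolding F_def by (rule E_linear[symmetric, OF kernel_cont[OF assms] bounded_linear_cnj])
  then show ?thesis by (simp add: F_def)
qed

lemma F_sums:
  assumes moments: "\<forall>j. has_stieltjes_integral (\<lambda>t. of_real t ^ j) \<mu> 0 1 (of_real (s j) :: complex)"
    and z: "norm z < 1"
  shows "F z = z * (\<Sum>n. of_real (s n) * z ^ n)"
proof -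
  have cut: "z \<in> cut_plane" using z ball_half_plane half_plane_cut_plane by simp
  have Em: "E (\<lambda>t. of_real t ^ j) = of_real (s j)" for j using moments E_eqI by blast
  have "(\<lambda>n. z * (of_real (s n) * z ^ n)) sums F z"
    unfolding sums_def
  proof (rule LIM_zero_cancel, rule Lim_null_comparison)
    show "(\<lambda>n. norm z ^ Suc n / (1 - norm z)) \<longlonglongrightarrow> 0"
      using z by (intro tendsto_divide_zero LIMSEQ_Suc LIMSEQ_realpow_zero) auto
    have "norm ((\<Sum>i<n. z * (of_real (s i) * z ^ i)) - F z) \<le> norm z ^ Suc n / (1 - norm z)" for n
    proof -
      have partial: "has_stieltjes_integral (\<lambda>t. \<Sum>i<n. z * z ^ i * of_real t ^ i) \<mu> 0 1
          (\<Sum>i<n. z * z ^ i * of_real (s i))" for n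
      proof (induction n)
        case 0
        show ?case
          using has_stieltjes_integral_bounded_linear[OF moments[rule_format, of 0] bounded_linear_zero] by simp
      next
        case (Suc n)
        then show ?case
          unfolding sum.lessThan_Suc
          by (intro has_stieltjes_integral_add
              has_stieltjes_integral_bounded_linear[OF moments[rule_format] bounded_linear_mult_right])
      qed
      have "(\<Sum>i<n. z * (of_real (s i) * z ^ i)) - F z
          = E (\<lambda>t. \<Sum>i<n. z * z ^ i * of_real t ^ i) - E (\<lambda>t. z / (1 - of_real t * z))"
        unfolding E_eqI[OF partial] F_def by (simp add: mult_ac)
      also have "\<dots> = E (\<lambda>t. (\<Sum>i<n. z * z ^ i * of_real t ^ i) - z / (1 - of_real t * z))"
        by (rule E_diff[symmetric]) (intro continuous_intros kernel_cont cut)+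
      also have "norm \<dots> \<le> norm z ^ Suc n / (1 - norm z)"
      proof (rule E_norm_le)
        show "continuous_on {0..1} (\<lambda>t. (\<Sum>i<n. z * z ^ i * of_real t ^ i) - z / (1 - of_real t * z))"
          by (intro continuous_intros continuous_on_diff kernel_cont cut)
        fix t :: real assume t: "t \<in> {0..1}"
        have nz: "1 - of_real t * z \<noteq> 0" using cut_plane_nz[OF cut t] .
        have "(\<Sum>i<n. z * z ^ i * of_real t ^ i) = z * (\<Sum>i<n. (of_real t * z) ^ i)"
          by (simp add: sum_distrib_left power_mult_distrib mult_ac)
        also have "(\<Sum>i<n. (of_real t * z) ^ i) = (1 - (of_real t * z) ^ n) / (1 - of_real t * z)"
          using nz by (subst sum_gp_strict) auto
        finally have eq: "(\<Sum>i<n. z * z ^ i * of_real t ^ i) - z / (1 - of_real t * z)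
            = - (of_real t ^ n * z ^ Suc n / (1 - of_real t * z))"
          using nz by (simp add: divide_simps) (simp add: algebra_simps power_mult_distrib)
        have "norm (of_real t ^ n * z ^ Suc n) \<le> norm z ^ Suc n"
          using t by (simp add: norm_mult norm_power mult_left_le_one_le power_le_one)
        moreover have "1 - norm z \<le> norm (1 - of_real t * z)"
        proof -
          have "norm (of_real t * z) \<le> norm z" using t by (simp add: norm_mult mult_left_le_one_le)
          then show ?thesis using norm_triangle_ineq2[of 1 "of_real t * z"] by simp
        qed
        ultimately show "norm ((\<Sum>i<n. z * z ^ i * of_real t ^ i) - z / (1 - of_real t * z))
            \<le> norm z ^ Suc n / (1 - norm z)"
          unfolding eq norm_minus_cancel norm_divide using z by (intro frac_le) auto
      qed
      finally show ?thesis .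
    qed
    then show "\<forall>\<^sub>F n in sequentially. norm ((\<Sum>i<n. z * (of_real (s i) * z ^ i)) - F z)
        \<le> norm z ^ Suc n / (1 - norm z)" by simp
  qed
  then have sums: "(\<lambda>n. z * (of_real (s n) * z ^ n)) sums F z" .
  show ?thesis
  proof (cases "z = 0")
    case True
    then show ?thesis using sums by (simp add: sums_iff)
  next
    case False
    then have "summable (\<lambda>n. of_real (s n) * z ^ n)" using sums_summable[OF sums] by (simp add: summable_cmult_iff)
    then show ?thesis using sums_unique[OF sums] suminf_mult by metis
  qed
qed

text \<open>
  Let \<open>N t = (1 - t z)(1 - t w)\<close>. Because \<open>Re z < 1\<close> and \<open>Re w < 1\<close>, \<open>Im (1/N t)\<close> is positive for
  \<open>t > 0\<close>, while \<open>1/N 0 = 1\<close>. So \<open>Im (1/N t) + \<epsilon> Re (1/N t)\<close> is positive on the whole interval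
  for small \<open>\<epsilon> > 0\<close>.
\<close>
lemma E_kernel_nonzero:
  assumes re: "Re z < 1" "Re w < 1" and "0 < Im z" "0 < Im w"
  shows "E (\<lambda>t. 1 / ((1 - of_real t * z) * (1 - of_real t * w))) \<noteq> 0"
proof
  define N where "N t = (1 - of_real t * z) * (1 - of_real t * w)" for t :: real
  assume zero: "E (\<lambda>t. 1 / ((1 - of_real t * z) * (1 - of_real t * w))) = 0"
  have cont: "continuous_on {0..1} (\<lambda>t. 1 / N t)"
    unfolding N_def by (intro kernel2_cont half_plane_cut_plane re)
  define \<sigma> where "\<sigma> = Im (z + w)"
  define \<beta> where "\<beta> = Im (z * w)"
  \<comment> \<open>\<open>\<sigma> - t \<beta>\<close> is affine in \<open>t\<close>, so \<open>\<kappa>\<close> bounds it from below on the unit interval\<close>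
  define \<kappa> where "\<kappa> = min \<sigma> (\<sigma> - \<beta>)"
  define M where "M = \<bar>Re (z + w)\<bar> + \<bar>Re (z * w)\<bar>"
  define \<epsilon> where "\<epsilon> = \<kappa> / (M + 1)"
  have "Re z * Im w < 1 * Im w" "Im z * Re w < Im z * 1"
    using assms by (simp_all only: mult_less_cancel_left_pos mult_less_cancel_right_pos)
  then have "\<beta> < \<sigma>" by (simp add: \<beta>_def \<sigma>_def)
  moreover have "\<sigma> > 0" using assms by (simp add: \<sigma>_def)
  ultimately have "\<kappa> > 0" by (simp add: \<kappa>_def)
  have "M \<ge> 0" by (simp add: M_def)
  then have "\<epsilon> > 0" "\<epsilon> * M \<le> \<kappa>" using \<open>\<kappa> > 0\<close> by (simp_all add: \<epsilon>_def field_simps)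
  have pos: "0 < Re ((of_real \<epsilon> - \<i>) * (1 / N t))" if t: "t \<in> {0..1}" for t
  proof -
    have nz: "N t \<noteq> 0" unfolding N_def using cut_plane_nz half_plane_cut_plane re t by auto
    have ReN: "Re (N t) = 1 - t * Re (z + w) + t * t * Re (z * w)"
      by (simp add: N_def algebra_simps)
    have ImN: "Im (N t) = - (t * (\<sigma> - t * \<beta>))"
      by (simp add: N_def \<sigma>_def \<beta>_def algebra_simps)
    have "\<kappa> \<le> (1 - t) * \<sigma> + t * (\<sigma> - \<beta>)"
    proof -
      have "(1 - t) * \<kappa> + t * \<kappa> \<le> (1 - t) * \<sigma> + t * (\<sigma> - \<beta>)"
        using t by (intro add_mono mult_left_mono) (auto simp: \<kappa>_def)
      then show ?thesis by (simp add: algebra_simps)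
    qed
    then have "\<kappa> \<le> \<sigma> - t * \<beta>" by (simp add: algebra_simps)
    then have "t * \<kappa> \<le> - Im (N t)" using t by (simp add: ImN mult_left_mono)
    moreover have "1 - t * M \<le> Re (N t)"
    proof -
      have "t * Re (z + w) \<le> t * \<bar>Re (z + w)\<bar>" using t by (intro mult_left_mono) auto
      moreover have "- (t * t * Re (z * w)) \<le> t * \<bar>Re (z * w)\<bar>"
      proof -
        have "- (t * t * Re (z * w)) \<le> (t * t) * \<bar>Re (z * w)\<bar>"
          unfolding mult_minus_right[symmetric] using t by (intro mult_left_mono abs_ge_minus_self) simp
        also have "\<dots> \<le> t * \<bar>Re (z * w)\<bar>" using t by (intro mult_right_mono) (auto simp: mult_left_le_one_le)
        finally show ?thesis .
      qed
      ultimately show ?thesis by (simp add: ReN M_def algebra_simps)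
    qed
    then have "\<epsilon> * (1 - t * M) \<le> \<epsilon> * Re (N t)" using \<open>\<epsilon> > 0\<close> by (intro mult_left_mono) auto
    moreover have "t * (\<epsilon> * M) \<le> t * \<kappa>" using t \<open>\<epsilon> * M \<le> \<kappa>\<close> by (intro mult_left_mono) auto
    ultimately have "0 < \<epsilon> * Re (N t) - Im (N t)" using \<open>\<epsilon> > 0\<close> by (simp add: algebra_simps)
    moreover have "Re ((of_real \<epsilon> - \<i>) * (1 / N t)) = (\<epsilon> * Re (N t) - Im (N t)) / ((Re (N t))\<^sup>2 + (Im (N t))\<^sup>2)"
      by (simp add: Re_divide Im_divide diff_divide_distrib)
    moreover have "(Re (N t))\<^sup>2 + (Im (N t))\<^sup>2 > 0"
      using nz by (simp add: complex_neq_0[symmetric])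
    ultimately show ?thesis by simp
  qed
  have "0 < Re (E (\<lambda>t. (of_real \<epsilon> - \<i>) * (1 / N t)))"
    by (rule E_Re_pos) (intro continuous_on_mult continuous_on_const cont, rule pos)
  also have "E (\<lambda>t. (of_real \<epsilon> - \<i>) * (1 / N t)) = (of_real \<epsilon> - \<i>) * E (\<lambda>t. 1 / N t)"
    by (rule E_cmult[OF cont])
  finally show False using zero by (simp add: N_def)
qed

text \<open>
  If \<open>Im z\<close> and \<open>Im w\<close> do not have the same strict sign, then the integrand of \<open>F_diff\<close> has positive
  real part. Otherwise \<open>E_kernel_nonzero\<close> applies, after conjugation if both are negative.
\<close>
lemma F_inj: "inj_on F {z. Re z < 1}"
proof (rule inj_onI, clarify, rule ccontr)
  fix z w assume re: "Re z < 1" "Re w < 1" and eq: "F z = F w" and "z \<noteq> w"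
  have zero: "E (\<lambda>t. 1 / ((1 - of_real t * z) * (1 - of_real t * w))) = 0"
    if "Re z < 1" "Re w < 1" "F z = F w" "z \<noteq> w" for z w
    using F_diff[of z w] half_plane_cut_plane that by simp
  consider "Im z * Im w \<le> 0" | "0 < Im z" "0 < Im w" | "0 < Im (cnj z)" "0 < Im (cnj w)"
    by (simp add: mult_le_0_iff) linarith
  then show False
  proof cases
    case 1
    have pos: "0 < Re (1 / ((1 - of_real t * z) * (1 - of_real t * w)))" if t: "t \<in> {0..1}" for t
    proof -
      define N where "N = (1 - of_real t * z) * (1 - of_real t * w)"
      have lt: "t * x < 1" if "x < 1" for x
      proof (cases "x \<le> 0")
        case True
        then have "t * x \<le> 0" using t by (simp add: mult_nonneg_nonpos)
        then show ?thesis by simp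
      next
        case False
        then have "t * x \<le> x" using t by (simp add: mult_left_le_one_le)
        then show ?thesis using that by simp
      qed
      have "Re N = (1 - t * Re z) * (1 - t * Re w) + t * t * (- (Im z * Im w))"
        by (simp add: N_def algebra_simps)
      moreover have "(1 - t * Re z) * (1 - t * Re w) > 0" using lt re by (intro mult_pos_pos) auto
      moreover have "t * t * (- (Im z * Im w)) \<ge> 0" using 1 t by (intro mult_nonneg_nonneg) auto
      ultimately have "Re N > 0" by linarith
      then show ?thesis unfolding N_def[symmetric]
        by (simp add: Re_divide zero_less_divide_iff add_pos_nonneg)
    qed
    have "0 < Re (E (\<lambda>t. 1 / ((1 - of_real t * z) * (1 - of_real t * w))))"
      by (rule E_Re_pos[OF kernel2_cont pos]) (intro half_plane_cut_plane re)+
    then show False using zero[OF re eq \<open>z \<noteq> w\<close>] by simp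
  next
    case 2
    then show False using E_kernel_nonzero[OF re] zero[OF re eq \<open>z \<noteq> w\<close>] by blast
  next
    case 3
    have "F (cnj z) = F (cnj w)" using F_cnj half_plane_cut_plane re eq by simp
    then have "E (\<lambda>t. 1 / ((1 - of_real t * cnj z) * (1 - of_real t * cnj w))) = 0"
      using re \<open>z \<noteq> w\<close> by (intro zero) auto
    then show False using E_kernel_nonzero[OF _ _ 3] re by simp
  qed
qed

end

section \<open>Convexity in the direction of the imaginary axis\<close>

text \<open>
  In the closed upper half of the disk a level set meets each circle \<open>norm z = r\<close> at most once, and
  by the intermediate value theorem the radii that occur form an interval reaching up to 1.
  So that half is a curve parametrised by the radius; continuity of the parametrisation comes from
  compactness. Its mirror image is attached to it at a real point.
\<close>
lemma circle_level_sets_connected: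
  fixes U :: "complex \<Rightarrow> real"
  assumes cont: "continuous_on (ball 0 1) U"
    and cnj: "\<And>z. z \<in> ball 0 1 \<Longrightarrow> U (cnj z) = U z"
    and circle: "\<And>z w. \<lbrakk>z \<in> ball 0 1; norm z = norm w; Re z < Re w\<rbrakk> \<Longrightarrow> U z < U w"
    and real: "\<And>x y. \<lbrakk>-1 < x; x \<le> y; y < 1\<rbrakk> \<Longrightarrow> U (of_real x) \<le> U (of_real y)"
  shows "connected {z \<in> ball 0 1. U z = u}"
proof -
  define L where "L = {z \<in> ball 0 1. 0 \<le> Im z \<and> U z = u}"
  have sq: "(norm z)\<^sup>2 = (Re z)\<^sup>2 + (Im z)\<^sup>2" for z by (rule cmod_power2)
  have inj: "inj_on norm L"
  proof (rule inj_onI)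
    fix z w assume z: "z \<in> L" and w: "w \<in> L" and eq: "norm z = norm w"
    have zb: "z \<in> ball 0 1" "U z = u" and wb: "w \<in> ball 0 1" "U w = u"
      using z w unfolding L_def by blast+
    have "\<not> Re z < Re w" using circle[OF zb(1) eq] unfolding zb(2) wb(2) by blast
    moreover have "\<not> Re w < Re z" using circle[OF wb(1) eq[symmetric]] unfolding zb(2) wb(2) by blast
    ultimately have "Re z = Re w" by simp
    moreover from this have "(Im z)\<^sup>2 = (Im w)\<^sup>2" using sq[of z] sq[of w] eq by simp
    then have "Im z = Im w" using z w by (simp add: L_def)
    ultimately show "z = w" by (simp add: complex_eq_iff)
  qed
  have between: "U (of_real (- norm z)) \<le> U z \<and> U z \<le> U (of_real (norm z))" if z: "z \<in> ball 0 1" for z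
  proof
    show "U z \<le> U (of_real (norm z))"
    proof (cases "Re z = norm z")
      case True
      then have "z = of_real (norm z)" using sq[of z] by (simp add: complex_eq_iff)
      then show ?thesis by simp
    next
      case False
      then have "Re z < norm z" using complex_Re_le_cmod[of z] by simp
      then show ?thesis using circle[of z "of_real (norm z)"] z by simp
    qed
    show "U (of_real (- norm z)) \<le> U z"
    proof (cases "Re z = - norm z")
      case True
      then have "z = of_real (- norm z)" using sq[of z] by (simp add: complex_eq_iff)
      then show ?thesis by simp
    next
      case False
      then have "- norm z < Re z" using abs_Re_le_cmod[of z] by (simp add: abs_le_iff)
      then show ?thesis using circle[of "of_real (- norm z)" z] z by simp
    qed
  qed
  have larger: "\<exists>w\<in>L. norm w = r" if z: "z \<in> L" and r: "norm z \<le> r" "r < 1" for z r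
  proof -
    have zb: "z \<in> ball 0 1" "U z = u" using z by (auto simp: L_def)
    have "0 \<le> r" using r(1) norm_ge_zero order_trans by blast
    have "U (of_real (- r)) \<le> U (of_real (- norm z))" "U (of_real (norm z)) \<le> U (of_real r)"
      using real[of "- r" "- norm z"] real[of "norm z" r] r norm_ge_zero[of z] by linarith+
    then have u: "U (of_real r * cis pi) \<le> u" "u \<le> U (of_real r * cis 0)"
      using between[OF zb(1)] zb(2) by simp_all
    have "continuous_on {0..pi} (\<lambda>t. U (of_real r * cis t))"
    proof (rule continuous_on_compose2[OF cont])
      show "continuous_on {0..pi} (\<lambda>t. of_real r * cis t)"
        by (intro continuous_intros)
      show "(\<lambda>t. of_real r * cis t) ` {0..pi} \<subseteq> ball 0 1"
        using \<open>0 \<le> r\<close> r(2) by (auto simp: norm_mult)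
    qed
    then obtain t where t: "0 \<le> t" "t \<le> pi" "U (of_real r * cis t) = u"
      using IVT2'[of "\<lambda>t. U (of_real r * cis t)" pi u 0] u by auto
    have "of_real r * cis t \<in> L"
      using t \<open>0 \<le> r\<close> r(2) by (simp add: L_def norm_mult sin_ge_zero)
    moreover have "norm (of_real r * cis t) = r" using \<open>0 \<le> r\<close> by (simp add: norm_mult)
    ultimately show ?thesis by blast
  qed
  have conn: "connected (L \<inter> cball 0 \<rho>)" if \<rho>: "\<rho> < 1" for \<rho>
  proof -
    let ?K = "L \<inter> cball 0 \<rho>"
    have sub: "cball 0 \<rho> \<subseteq> ball 0 (1::real) \<or> True" by simp
    have "?K = {z \<in> cball 0 \<rho>. U z \<in> {u}} \<inter> {z. 0 \<le> Im z}"
      using that by (auto simp: L_def)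
    moreover have "cball 0 \<rho> \<subseteq> ball (0 :: complex) 1" using that by auto
    then have "closed {z \<in> cball 0 \<rho>. U z \<in> {u}}"
      using continuous_closed_preimage[OF continuous_on_subset[OF cont], of "cball 0 \<rho>" "{u}"]
      by (simp add: vimage_def Int_def)
    ultimately have "closed ?K" by (simp add: closed_Int closed_halfspace_Im_ge)
    then have comp: "compact ?K" by (simp add: closed_Int_compact compact_Int_closed Int_absorb2
          compact_eq_bounded_closed bounded_Int)
    have "is_interval (norm ` ?K)"
      unfolding is_interval_1
    proof (intro ballI allI impI)
      fix a b x assume a: "a \<in> norm ` ?K" and b: "b \<in> norm ` ?K" and x: "a \<le> x \<and> x \<le> b"
      obtain z where z: "z \<in> L" "norm z \<le> x" using a x by auto
      have "x \<le> \<rho>" using b x by auto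
      then obtain w where "w \<in> L" "norm w = x" using larger[OF z] \<rho> by auto
      then show "x \<in> norm ` ?K" using \<open>x \<le> \<rho>\<close> by (auto intro!: image_eqI[of _ _ w])
    qed
    then have "connected (norm ` ?K)" by (rule is_interval_connected)
    have injK: "inj_on norm ?K" using inj by (rule inj_on_subset) auto
    have "continuous_on (norm ` ?K) (inv_into ?K norm)"
      by (rule continuous_on_inv[OF _ comp]) (auto intro: continuous_on_norm_id inv_into_f_f[OF injK])
    then have "connected (inv_into ?K norm ` norm ` ?K)"
      using \<open>connected (norm ` ?K)\<close> by (rule connected_continuous_image)
    then show ?thesis using inv_into_image_cancel[OF injK order_refl] by simp
  qed
  have "connected L"
    unfolding connected_iff_connected_component
  proof (intro ballI)
    fix z w assume z: "z \<in> L" and w: "w \<in> L"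
    let ?\<rho> = "max (norm z) (norm w)"
    have "?\<rho> < 1" using z w by (simp add: L_def)
    then have "connected (L \<inter> cball 0 ?\<rho>)" by (rule conn)
    moreover have "z \<in> L \<inter> cball 0 ?\<rho>" "w \<in> L \<inter> cball 0 ?\<rho>" using z w by auto
    ultimately show "connected_component L z w"
      unfolding connected_component_def by blast
  qed
  then have conn2: "connected (cnj ` L)"
    by (rule connected_continuous_image[rotated]) (intro continuous_intros)
  have "{z \<in> ball 0 1. U z = u} = L \<union> cnj ` L"
  proof (intro set_eqI iffI)
    fix z assume z: "z \<in> {z \<in> ball 0 1. U z = u}"
    show "z \<in> L \<union> cnj ` L"
    proof (cases "0 \<le> Im z")
      case True
      then show ?thesis using z by (simp add: L_def)
    next
      case False
      then have "cnj z \<in> L" using z cnj[of z] by (simp add: L_def)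
      then show ?thesis by (auto intro!: image_eqI[of z cnj "cnj z"])
    qed
  next
    fix z assume "z \<in> L \<union> cnj ` L"
    then show "z \<in> {z \<in> ball 0 1. U z = u}" using cnj by (auto simp: L_def)
  qed
  moreover have "connected (L \<union> cnj ` L)"
  proof (cases "L = {}")
    case False
    then obtain z where z: "z \<in> L" by blast
    then have zb: "z \<in> ball 0 1" "U z = u" by (auto simp: L_def)
    have "continuous_on {- norm z..norm z} (\<lambda>x. U (of_real x))"
      by (rule continuous_on_compose2[OF cont]) (use zb in \<open>auto intro!: continuous_intros\<close>)
    then obtain x where x: "- norm z \<le> x" "x \<le> norm z" "U (of_real x) = u"
      using IVT'[of "\<lambda>x. U (of_real x)" "- norm z" u "norm z"] between[OF zb(1)] zb by auto
    then have "of_real x \<in> L" using zb by (auto simp: L_def)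
    then have "of_real x \<in> L \<inter> cnj ` L" by (auto intro!: image_eqI[of _ cnj "of_real x"])
    then show ?thesis using \<open>connected L\<close> conn2 by (intro connected_Un) auto
  qed simp
  ultimately show ?thesis by simp
qed

text \<open>
  On the circle \<open>norm z = r\<close> the real part is \<open>(x - \<tau> r\<^sup>2)/(1 - 2 \<tau> x + \<tau>\<^sup>2 r\<^sup>2)\<close> with \<open>x = Re z\<close>, and the
  cross-multiplied difference is \<open>(x' - x)(1 - \<tau>\<^sup>2 r\<^sup>2)\<close>.
\<close>
lemma Re_moebius_kernel_less:
  fixes z w :: complex
  assumes r: "norm z = norm w" "norm w < 1" and less: "Re z < Re w" and \<tau>: "\<bar>\<tau>\<bar> \<le> 1"
  shows "Re (z / (1 - of_real \<tau> * z)) < Re (w / (1 - of_real \<tau> * w))"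
proof -
  define D where "D x = 1 - 2 * \<tau> * x + \<tau>\<^sup>2 * (norm w)\<^sup>2" for x
  have small: "\<bar>\<tau>\<bar> * norm w < 1"
    using mult_left_le_one_le[of "norm w" "\<bar>\<tau>\<bar>"] \<tau> r by simp
  have eq: "Re (y / (1 - of_real \<tau> * y)) = (Re y - \<tau> * (norm w)\<^sup>2) / D (Re y) \<and> D (Re y) > 0"
    if "norm y = norm w" for y
  proof -
    have sq: "(norm w)\<^sup>2 = (Re y)\<^sup>2 + (Im y)\<^sup>2" by (metis cmod_power2 that)
    have den: "(1 - \<tau> * Re y)\<^sup>2 + (\<tau> * Im y)\<^sup>2 = D (Re y)"
      unfolding D_def sq by (simp add: power2_eq_square algebra_simps)
    have num: "Re y * (1 - \<tau> * Re y) - Im y * (\<tau> * Im y) = Re y - \<tau> * (norm w)\<^sup>2"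
      unfolding sq by (simp add: power2_eq_square algebra_simps)
    have "norm (of_real \<tau> * y) < 1" using small that by (simp add: norm_mult)
    then have "1 - of_real \<tau> * y \<noteq> 0" by auto
    then have "(norm (1 - of_real \<tau> * y))\<^sup>2 > 0" by simp
    then have "(1 - \<tau> * Re y)\<^sup>2 + (\<tau> * Im y)\<^sup>2 > 0" unfolding cmod_power2 by simp
    then have "D (Re y) > 0" by (simp only: den)
    moreover have "Re (y / (1 - of_real \<tau> * y)) = (Re y - \<tau> * (norm w)\<^sup>2) / D (Re y)"
      unfolding Re_divide using num den by simp
    ultimately show ?thesis by simp
  qed
  have "(\<bar>\<tau>\<bar> * norm w)\<^sup>2 < 1" using small by (simp add: power_less_one_iff abs_square_less_1)
  then have "0 < (Re w - Re z) * (1 - \<tau>\<^sup>2 * (norm w)\<^sup>2)"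
    using less by (simp add: power_mult_distrib)
  also have "\<dots> = (Re w - \<tau> * (norm w)\<^sup>2) * D (Re z) - (Re z - \<tau> * (norm w)\<^sup>2) * D (Re w)"
    by (simp add: D_def power2_eq_square algebra_simps)
  finally have "(Re z - \<tau> * (norm w)\<^sup>2) / D (Re z) < (Re w - \<tau> * (norm w)\<^sup>2) / D (Re w)"
    using eq[OF r(1)] eq[of w] by (simp add: divide_simps)
  then show ?thesis using eq[OF r(1)] eq[of w] by simp
qed

lemma real_moebius_kernel_mono:
  fixes x y \<tau> :: real
  assumes "-1 < x" "x < y" "y < 1" "\<bar>\<tau>\<bar> \<le> 1"
  shows "x / (1 - \<tau> * x) < y / (1 - \<tau> * y)"
proof -
  have "1 - \<tau> * v > 0" if "\<bar>v\<bar> < 1" for v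
  proof -
    have "\<bar>\<tau> * v\<bar> \<le> \<bar>v\<bar>" using assms by (simp add: abs_mult mult_left_le_one_le)
    then show ?thesis using that by linarith
  qed
  then have "1 - \<tau> * x > 0" "1 - \<tau> * y > 0" using assms by simp_all
  then show ?thesis using assms by (simp add: divide_simps) (simp add: algebra_simps)
qed

text \<open>
  The inverse map is \<open>z \<mapsto> z/(2 - z)\<close>, and \<open>Re z < 1\<close> says that \<open>z\<close> is closer to 0 than to 2.
\<close>
lemma disc_to_half_plane: "(\<lambda>w. 2 * w / (1 + w)) ` ball 0 1 = {z :: complex. Re z < 1}"
proof (intro set_eqI iffI)
  fix z :: complex assume "z \<in> (\<lambda>w. 2 * w / (1 + w)) ` ball 0 1"
  then obtain w where w: "norm w < 1" "z = 2 * w / (1 + w)" by auto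
  have "1 + w \<noteq> 0" using w(1) by (metis add.commute add_eq_0_iff norm_minus_cancel norm_one order_less_irrefl)
  then have pos: "(Re (1 + w))\<^sup>2 + (Im (1 + w))\<^sup>2 > 0" using complex_neq_0 by blast
  have "(Re w)\<^sup>2 + (Im w)\<^sup>2 < 1"
    using w(1) cmod_power2[of w] by (simp add: abs_square_less_1 flip: cmod_power2)
  then have "Re (2 * w) * Re (1 + w) + Im (2 * w) * Im (1 + w) < (Re (1 + w))\<^sup>2 + (Im (1 + w))\<^sup>2"
    by (simp add: power2_eq_square algebra_simps)
  then show "z \<in> {z. Re z < 1}" using pos by (simp add: w(2) Re_divide)
next
  fix z :: complex assume "z \<in> {z. Re z < 1}"
  then have "Re z < 1" by simp
  then have nz: "2 - z \<noteq> 0" by auto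
  have "(norm z)\<^sup>2 < (norm (2 - z))\<^sup>2"
    unfolding cmod_power2 using \<open>Re z < 1\<close> by (simp add: power2_eq_square algebra_simps)
  then have "norm z < norm (2 - z)" by (rule power_less_imp_less_base) simp
  then have "norm (z / (2 - z)) < 1" using nz by (simp add: norm_divide)
  moreover have "z = 2 * (z / (2 - z)) / (1 + z / (2 - z))"
  proof -
    have "1 + z / (2 - z) = 2 / (2 - z)" using nz by (simp add: field_simps)
    then show ?thesis using nz by simp
  qed
  ultimately show "z \<in> (\<lambda>w. 2 * w / (1 + w)) ` ball 0 1" by (intro image_eqI) auto
qed

context stieltjes_distribution begin

lemma moebius_image_vertical_convex:
  fixes G :: "complex \<Rightarrow> complex" and \<tau> :: "real \<Rightarrow> real"
  assumes hol: "G holomorphic_on ball 0 1" and inj: "inj_on G (ball 0 1)"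
    and \<tau>: "continuous_on {0..1} \<tau>" "\<And>t. t \<in> {0..1} \<Longrightarrow> \<bar>\<tau> t\<bar> \<le> 1" and "0 < c"
    and G: "\<And>z. z \<in> ball 0 1 \<Longrightarrow> G z = E (\<lambda>t. of_real c * (z / (1 - of_real (\<tau> t) * z)))"
  shows "convex_in_imaginary_direction (G ` ball 0 1)"
proof -
  define k where "k z t = of_real c * (z / (1 - of_real (\<tau> t) * z))" for z :: complex and t
  have cont: "continuous_on (ball 0 1) G" using hol by (rule holomorphic_on_imp_continuous_on)
  have nz: "1 - of_real (\<tau> t) * z \<noteq> 0" if "t \<in> {0..1}" "norm z < 1" for t and z :: complex
  proof -
    have "norm (of_real (\<tau> t) * z) < 1"
      using \<tau>(2)[OF that(1)] mult_left_le_one_le[of "norm z" "\<bar>\<tau> t\<bar>"] that(2) by (simp add: norm_mult)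
    then show ?thesis by auto
  qed
  have k_cont: "continuous_on {0..1} (k z)" if "norm z < 1" for z
    unfolding k_def using nz that by (intro continuous_intros \<tau>(1)) auto
  have less: "Re (G z) < Re (G w)"
    if zw: "norm z < 1" "norm w < 1"
      and less_t: "\<And>t. t \<in> {0..1} \<Longrightarrow> Re (z / (1 - of_real (\<tau> t) * z)) < Re (w / (1 - of_real (\<tau> t) * w))" for z w
  proof -
    have "0 < Re (E (\<lambda>t. k w t - k z t))"
    proof (rule E_Re_pos)
      show "continuous_on {0..1} (\<lambda>t. k w t - k z t)" by (intro continuous_on_diff k_cont zw)
      show "0 < Re (k w t - k z t)" if "t \<in> {0..1}" for t
        using less_t[OF that] \<open>0 < c\<close> by (simp add: k_def del: times_divide_eq_right)
    qed
    also have "E (\<lambda>t. k w t - k z t) = G w - G z"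
      using zw by (simp only: E_diff k_cont G[folded k_def] mem_ball_0)
    finally show ?thesis by simp
  qed
  have level: "connected {z \<in> ball 0 1. Re (G z) = u}" for u
  proof (rule circle_level_sets_connected)
    show "continuous_on (ball 0 1) (\<lambda>z. Re (G z))" by (intro continuous_intros cont)
    fix z :: complex assume z: "z \<in> ball 0 1"
    have "cnj (G z) = E (\<lambda>t. cnj (k z t))"
      using z by (simp only: G[folded k_def] E_linear[OF k_cont bounded_linear_cnj] mem_ball_0)
    also have "\<dots> = G (cnj z)" using z by (simp add: G k_def)
    finally show "Re (G (cnj z)) = Re (G z)" by (metis cnj.sel(1))
  next
    fix z w :: complex assume "z \<in> ball 0 1" "norm z = norm w" "Re z < Re w"
    then show "Re (G z) < Re (G w)"
      by (intro less Re_moebius_kernel_less \<tau>(2)) simp_all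
  next
    fix x y :: real assume xy: "-1 < x" "x \<le> y" "y < 1"
    show "Re (G (of_real x)) \<le> Re (G (of_real y))"
    proof (cases "x = y")
      case False
      have "Re (of_real x / (1 - of_real (\<tau> t) * of_real x)) < Re (of_real y / (1 - of_real (\<tau> t) * of_real y))"
        if "t \<in> {0..1}" for t
      proof -
        have "of_real v / (1 - of_real (\<tau> t) * of_real v) = complex_of_real (v / (1 - \<tau> t * v))" for v
          by simp
        then show ?thesis using real_moebius_kernel_mono[of x y "\<tau> t"] \<tau>(2)[OF that] xy False less_le
          by (simp only: Re_complex_of_real)
      qed
      then have "Re (G (of_real x)) < Re (G (of_real y))"
        using xy by (intro less) auto
      then show ?thesis by simp
    qed simp
  qed
  have "connected (G ` ball 0 1 \<inter> {w. Re w = x})" for x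
  proof -
    have "G ` ball 0 1 \<inter> {w. Re w = x} = G ` {z \<in> ball 0 1. Re (G z) = x}" by auto
    moreover have "connected (G ` {z \<in> ball 0 1. Re (G z) = x})"
      by (rule connected_continuous_image[OF continuous_on_subset[OF cont] level]) auto
    ultimately show ?thesis by simp
  qed
  moreover have "connected (G ` ball 0 1)"
    by (rule connected_continuous_image[OF cont]) simp
  moreover have "open (G ` ball 0 1)"
    by (rule open_mapping_thm3[OF hol _ inj]) simp
  ultimately show ?thesis unfolding convex_in_imaginary_direction_def by simp
qed

lemma F_ball_convex: "convex_in_imaginary_direction (F ` ball 0 1)"
proof (rule moebius_image_vertical_convex[where \<tau> = "\<lambda>t. t" and c = 1])
  show "F holomorphic_on ball 0 1"
    using ball_half_plane half_plane_cut_plane by (intro holomorphic_on_subset[OF F_holomorphic]) blast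
  show "inj_on F (ball 0 1)"
    using ball_half_plane by (intro inj_on_subset[OF F_inj]) blast
qed (auto simp: F_def continuous_on_id)

lemma F_half_plane_convex: "convex_in_imaginary_direction (F ` {z. Re z < 1})"
proof -
  define h :: "complex \<Rightarrow> complex" where "h w = 2 * w / (1 + w)" for w
  define G where "G w = F (h w)" for w
  have h_image: "h ` ball 0 1 = {z. Re z < 1}" using disc_to_half_plane by (simp add: h_def[abs_def])
  have nz: "1 + w \<noteq> 0" if "w \<in> ball 0 1" for w :: complex
    using that by (metis add.commute add_eq_0_iff mem_ball_0 norm_minus_cancel norm_one order_less_irrefl)
  have "convex_in_imaginary_direction (G ` ball 0 1)"
  proof (rule moebius_image_vertical_convex[where \<tau> = "\<lambda>t. 2 * t - 1" and c = 2])
    have hh: "h holomorphic_on ball 0 1"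
      unfolding h_def[abs_def] using nz by (intro holomorphic_intros) auto
    have "(F \<circ> h) holomorphic_on ball 0 1"
      using h_image half_plane_cut_plane
      by (intro holomorphic_on_compose_gen[OF hh F_holomorphic]) blast
    then show "G holomorphic_on ball 0 1" by (simp add: G_def[abs_def] comp_def)
    have "inj_on h (ball 0 1)"
    proof (rule inj_onI)
      fix v w assume "v \<in> ball 0 1" "w \<in> ball 0 1" "h v = h w"
      then have "2 * v * (1 + w) = 2 * w * (1 + v)" using nz by (simp add: h_def frac_eq_eq)
      then show "v = w" by (simp add: algebra_simps)
    qed
    then have "inj_on (F \<circ> h) (ball 0 1)" by (rule comp_inj_on) (simp add: h_image F_inj)
    then show "inj_on G (ball 0 1)" by (simp add: G_def[abs_def] comp_def)
    show "continuous_on {0..1} (\<lambda>t::real. 2 * t - 1)" by (intro continuous_intros)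
    fix w :: complex assume w: "w \<in> ball 0 1"
    have "h w / (1 - of_real t * h w) = of_real 2 * (w / (1 - of_real (2 * t - 1) * w))"
      if t: "t \<in> {0..1}" for t
    proof -
      have "h w \<in> cut_plane" using w h_image half_plane_cut_plane by blast
      then have "1 - of_real t * h w \<noteq> 0" using cut_plane_nz t by blast
      moreover have "1 - of_real t * h w = (1 - of_real (2 * t - 1) * w) / (1 + w)"
        using nz[OF w] by (simp add: h_def field_simps)
      ultimately show ?thesis using nz[OF w] by (simp add: h_def)
    qed
    then show "G w = E (\<lambda>t. of_real 2 * (w / (1 - of_real (2 * t - 1) * w)))"
      unfolding G_def F_def by (rule E_cong)
  qed (auto simp: abs_le_iff)
  moreover have "G ` ball 0 1 = F ` {z. Re z < 1}"
    unfolding h_image[symmetric] by (simp add: G_def image_image)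
  ultimately show ?thesis by simp
qed

end

section \<open>The integral representation and its mapping properties\<close>

theorem theorem2p3:
  fixes q a b c :: real
  assumes "0 < q" and "q < 1"
    and "0 \<le> a" and "0 \<le> b" and "0 \<le> c"
    and "0 \<le> q * (b - c)" and "q * (b - c) \<le> 1 - c * q"
    and "0 < a - c" and "a - c \<le> 1 - c"
  shows "\<exists>\<mu> :: real \<Rightarrow> real.
    mono_on {0..1} \<mu> \<and> \<mu> ` {0..1} \<subseteq> {0..1} \<and> \<mu> 1 - \<mu> 0 = 1 \<and>
    (let F = (\<lambda>z :: complex. stieltjes_integral (\<lambda>t. z / (1 - of_real t * z)) \<mu> 0 1) in
      (\<forall>z\<in>cut_plane. stieltjes_integrable (\<lambda>t. z / (1 - of_real t * z)) \<mu> 0 1) \<and>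
      (\<forall>z\<in>ball 0 1.
         heine_Phi (of_real a) (of_real b) (of_real c) (of_real q) (of_real q * z) \<noteq> 0 \<and>
         z * heine_Phi (of_real a) (of_real (b * q)) (of_real (c * q)) (of_real q) (of_real q * z)
           / heine_Phi (of_real a) (of_real b) (of_real c) (of_real q) (of_real q * z) = F z) \<and>
      F analytic_on cut_plane \<and>
      univalent_on F (ball 0 1) \<and>
      convex_in_imaginary_direction (F ` ball 0 1) \<and>
      univalent_on F {z. Re z < 1} \<and>
      convex_in_imaginary_direction (F ` {z. Re z < 1}))"
proof -
  note q = \<open>0 < q\<close> \<open>q < 1\<close>
  have adm: "admissible q a b c"
    using assms by (simp add: admissible_def zero_le_mult_iff algebra_simps)
  obtain s where s: "completely_monotone s" "s 0 = 1"
    and prod: "\<forall>z :: complex. norm z < 1 \<longrightarrow>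
      (\<Sum>n. of_real (s n) * z ^ n) * (\<Sum>n. of_real (fps_nth (heine_fps q a b c) n) * z ^ n)
        = (\<Sum>n. of_real (fps_nth (heine_fps q a (b * q) (c * q)) n) * z ^ n)"
    using heine_ratio_product[OF q adm] by blast
  obtain \<mu> where \<mu>: "mono \<mu>" "range \<mu> \<subseteq> {0..1}" "\<mu> 0 = 0" "\<mu> 1 = 1"
    and int: "\<forall>f :: real \<Rightarrow> complex. continuous_on {0..1} f \<longrightarrow> stieltjes_integrable f \<mu> 0 1"
    and mom: "\<forall>j. has_stieltjes_integral (\<lambda>t. of_real t ^ j :: complex) \<mu> 0 1 (of_real (s j))"
    by (rule hausdorff_moment[OF s])
  interpret stieltjes_distribution \<mu>
    using \<mu> int by unfold_locales (auto intro: mono_onI monoD)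
  have F_eq: "(\<lambda>z. stieltjes_integral (\<lambda>t. z / (1 - of_real t * z)) \<mu> 0 1) = F"
    by (simp add: F_def[abs_def] E_def)
  have ratio: "heine_Phi (of_real a) (of_real b) (of_real c) (of_real q) (of_real q * z) \<noteq> 0 \<and>
         z * heine_Phi (of_real a) (of_real (b * q)) (of_real (c * q)) (of_real q) (of_real q * z)
           / heine_Phi (of_real a) (of_real b) (of_real c) (of_real q) (of_real q * z) = F z"
    if "z \<in> ball 0 1" for z
  proof -
    have z: "norm z < 1" using that by simp
    define S0 where "S0 = (\<Sum>n. of_real (fps_nth (heine_fps q a b c) n) * z ^ n)"
    define S1 where "S1 = (\<Sum>n. of_real (fps_nth (heine_fps q a (b * q) (c * q)) n) * z ^ n)"
    define Q where "Q = (\<Sum>n. of_real (s n) * z ^ n)"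
    have "S0 \<noteq> 0" unfolding S0_def by (rule heine_series_nonzero[OF q adm z])
    moreover have "Q * S0 = S1" using prod z unfolding S0_def S1_def Q_def by blast
    moreover have "F z = z * Q" unfolding Q_def by (rule F_sums[OF mom z])
    ultimately have "S0 \<noteq> 0 \<and> z * S1 / S0 = F z" by (simp add: field_simps)
    then show ?thesis unfolding heine_Phi_eq_series S0_def S1_def .
  qed
  have analytic: "F analytic_on cut_plane"
    using F_holomorphic by (simp add: analytic_on_open open_cut_plane)
  have "{z. Re z < 1} \<subseteq> cut_plane" using half_plane_cut_plane by blast
  then have univ: "univalent_on F {z. Re z < 1}"
    unfolding univalent_on_def using analytic F_inj analytic_on_subset by blast
  have "ball 0 1 \<subseteq> {z. Re z < 1}" using ball_half_plane by blast
  then have univ': "univalent_on F (ball 0 1)"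
    using univ unfolding univalent_on_def by (blast intro: analytic_on_subset inj_on_subset)
  show ?thesis
  proof (intro exI[of _ \<mu>] conjI)
    show "mono_on {0..1} \<mu>" by (rule mono)
    show "\<mu> ` {0..1} \<subseteq> {0..1}" using \<mu>(2) by blast
    show "\<mu> 1 - \<mu> 0 = 1" by (rule mass)
    show "let F = (\<lambda>z :: complex. stieltjes_integral (\<lambda>t. z / (1 - of_real t * z)) \<mu> 0 1) in
      (\<forall>z\<in>cut_plane. stieltjes_integrable (\<lambda>t. z / (1 - of_real t * z)) \<mu> 0 1) \<and>
      (\<forall>z\<in>ball 0 1.
         heine_Phi (of_real a) (of_real b) (of_real c) (of_real q) (of_real q * z) \<noteq> 0 \<and>
         z * heine_Phi (of_real a) (of_real (b * q)) (of_real (c * q)) (of_real q) (of_real q * z)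
           / heine_Phi (of_real a) (of_real b) (of_real c) (of_real q) (of_real q * z) = F z) \<and>
      F analytic_on cut_plane \<and>
      univalent_on F (ball 0 1) \<and>
      convex_in_imaginary_direction (F ` ball 0 1) \<and>
      univalent_on F {z. Re z < 1} \<and>
      convex_in_imaginary_direction (F ` {z. Re z < 1})"
      unfolding Let_def F_eq
      using integrable[OF kernel_cont] ratio analytic univ univ' F_ball_convex F_half_plane_convex
      by blast
  qed
qed

end
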